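(* Let $m>1$ be an integer, $n=2m$, and let $X_1,\dots,X_m,T_1,\dots,T_m$ be mutually independent random variables, each uniformly distributed on $[-1,1]$. Put $X_{m+1}:=X_1$ and $$S_k = X_k - X_{k+1}\qquad (k=1,\dots,m),$$ and let $$Y_{2k-1}=\frac{S_k}{2}+\left(1-\frac{|S_k|}{2}\right)T_k,\qquad Y_{2k}=\frac{S_k}{2}-\left(1-\frac{|S_k|}{2}\right)T_k\qquad (k=1,\dots,m).$$ Then $\vec Y=(Y_1,\dots,Y_n)$ is a random balanced sample of size $n=2m$ that is maximally robust, i.e. the support of its distribution is a set of dimension $n-1$. Moreover, the distribution of $\vec Y$ is given by a density on $M(n)$ (with respect to $(n-1)$-dimensional volume on $M(n)$).
   Context: A random balanced sample (RBS) of size $n$ is a system of random variables $\vec X=(X_1,\dots,X_n)$ such that $\sum_{k=1}^n X_k=0$ and each $X_k$ is uniformly distributed on $[-1,1]$. $M(n)=\{\vec x\in[-1,1]^n:\sum_{k=1}^n x_k=0\}$, a polytope of dimension $n-1$ in the hyperplane $\{\vec x\in\mathbb{R}^n:\sum_k x_k=0\}$; the distribution of any RBS of size $n$ is supported in $M(n)$. The $(n-1)$-dimensional volume on $M(n)$ is the $(n-1)$-dimensional Lebesgue measure on this hyperplane (regarded as an isometric copy of $\mathbb{R}^{n-1}$). An RBS of size $n$ is called maximally robust if the support of its distribution has dimension $n-1$. *)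

theory Defs
  imports "HOL-Probability.Probability"
begin

definition uniform_rv :: "'w measure \<Rightarrow> ('w \<Rightarrow> real) \<Rightarrow> bool" where
  "uniform_rv M X \<longleftrightarrow>
     X \<in> borel_measurable M \<and> distr M borel X = uniform_measure lborel {-1..1}"

text \<open>A system of \<open>n\<close> random variables is a random vector in \<open>real ^ 'n\<close> with
  \<open>n = CARD('n)\<close>; the balance condition is required pointwise, not only almost surely.\<close>

definition random_balanced_sample :: "'w measure \<Rightarrow> ('w \<Rightarrow> real ^ 'n) \<Rightarrow> bool" where
  "random_balanced_sample M X \<longleftrightarrow>
     (\<forall>\<omega>\<in>space M. (\<Sum>i\<in>UNIV. X \<omega> $ i) = 0) \<and> (\<forall>i. uniform_rv M (\<lambda>\<omega>. X \<omega> $ i))"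

definition balanced_hyperplane :: "(real ^ 'n) set" where
  "balanced_hyperplane = {x. (\<Sum>i\<in>UNIV. x $ i) = 0}"

definition balanced_polytope :: "(real ^ 'n) set" where
  "balanced_polytope = {x \<in> balanced_hyperplane. \<forall>i. x $ i \<in> {-1..1}}"

definition orthonormal_basis_of :: "'a::euclidean_space set \<Rightarrow> 'a set \<Rightarrow> bool" where
  "orthonormal_basis_of V B \<longleftrightarrow>
     B \<subseteq> V \<and> pairwise orthogonal B \<and> (\<forall>b\<in>B. norm b = 1) \<and> span B = V"

lemma orthonormal_basis_of_finite:
  assumes "orthonormal_basis_of V B"
  shows "finite B"
  using assms pairwise_orthogonal_imp_finite
  by (auto simp: orthonormal_basis_of_def)

lemma orthonormal_basis_of_exists:
  fixes V :: "'a::euclidean_space set"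
  assumes "subspace V"
  obtains B where "orthonormal_basis_of V B"
  using orthonormal_basis_subspace[OF assms] unfolding orthonormal_basis_of_def by metis

text \<open>Lebesgue measure on a linear subspace \<open>V\<close>, as a Borel measure on the ambient space: the
  image of the product Lebesgue measure under the isometry taking coordinates with respect to an
  orthonormal basis \<open>B\<close> of \<open>V\<close> to the corresponding vector (cf. \<open>lborel_eq\<close>, which is the case
  \<open>V = UNIV\<close>, \<open>B = Basis\<close>). By orthogonal invariance of Lebesgue measure it does not depend on
  the choice of \<open>B\<close>.\<close>

definition lborel_subspace :: "'a::euclidean_space set \<Rightarrow> 'a measure" where
  "lborel_subspace V =
     (let B = (SOME B. orthonormal_basis_of V B)
      in distr (\<Pi>\<^sub>M b\<in>B. lborel) borel (\<lambda>t. \<Sum>b\<in>B. t b *\<^sub>R b))"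

text \<open>The \<open>(n-1)\<close>-dimensional volume on the polytope. It is kept as a Borel measure on the whole
  space, vanishing off the polytope, rather than as a \<open>restrict_space\<close>: a random balanced sample
  takes values in the polytope only almost surely.\<close>

definition polytope_volume :: "(real ^ 'n) measure" where
  "polytope_volume = density (lborel_subspace balanced_hyperplane) (indicator balanced_polytope)"

definition measure_support :: "'a::topological_space measure \<Rightarrow> 'a set" where
  "measure_support N = {x. \<forall>U. open U \<and> x \<in> U \<longrightarrow> emeasure N U > 0}"

definition hausdorff_premeasure :: "real \<Rightarrow> real \<Rightarrow> 'a::metric_space set \<Rightarrow> ennreal" where
  "hausdorff_premeasure s \<delta> A =
     (INF U \<in> {U :: nat \<Rightarrow> 'a set. A \<subseteq> (\<Union>i. U i) \<and> (\<forall>i. bounded (U i) \<and> diameter (U i) \<le> \<delta>)}.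
        \<Sum>i. ennreal (diameter (U i) powr s))"

definition hausdorff_measure :: "real \<Rightarrow> 'a::metric_space set \<Rightarrow> ennreal" where
  "hausdorff_measure s A = (SUP \<delta> \<in> {0<..}. hausdorff_premeasure s \<delta> A)"

text \<open>Only exponents \<open>s > 0\<close> are used, so the convention \<open>0 powr 0 = 0\<close> has no effect.\<close>

definition hausdorff_dim :: "'a::metric_space set \<Rightarrow> ennreal" where
  "hausdorff_dim A = (INF s \<in> {s. s > 0 \<and> hausdorff_measure s A = 0}. ennreal s)"

text \<open>The support of a distribution is an arbitrary closed set, so its dimension is taken to be the
  Hausdorff dimension; the affine dimension would be too coarse, since already a set of \<open>n\<close> affinely
  independent points has affine dimension \<open>n - 1\<close>.\<close>

definition maximally_robust :: "'w measure \<Rightarrow> ('w \<Rightarrow> real ^ 'n) \<Rightarrow> bool" where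
  "maximally_robust M X \<longleftrightarrow>
     hausdorff_dim (measure_support (distr M borel X)) = of_nat (CARD('n) - 1)"

end

theory Submission
  imports Defs
begin

text \<open>
  If \<open>\<bar>y\<bar> \<le> 1\<close>, the point \<open>y\<close> lies on the segment \<open>{s/2 + (1 - \<bar>s\<bar>/2) t |t. \<bar>t\<bar> \<le> 1}\<close> iff
  \<open>\<bar>y - s\<bar> \<le> 1\<close>. The density \<open>(2 - \<bar>s\<bar>)/4\<close> of a difference of two independent uniform variables
  cancels the density \<open>1/(2 - \<bar>s\<bar>)\<close> on that segment, so the joint density of \<open>(S\<^sub>k, Y\<^sub>i)\<close> is constant on a
  region whose sections over \<open>[-1, 1]\<close> all have length \<open>2\<close>; hence \<open>Y\<^sub>i\<close> is uniform.

  The vector of samples determines every \<open>S\<^sub>k\<close> and (when \<open>\<bar>S\<^sub>k\<bar> < 2\<close>) every \<open>T\<^sub>k\<close>, so together with the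
  single value \<open>X\<^sub>1\<close> it determines all the variables, and it does so differentiably off finitely many
  hyperplanes. Adding \<open>X\<^sub>1\<close> times the unit normal of the balanced hyperplane therefore gives a map
  under which preimages of null sets are null, so the distribution of the samples is absolutely
  continuous with respect to the volume on the hyperplane, and Radon--Nikodym yields the density.
  The support carries the whole distribution, so it has positive volume, and a bounded subset of an
  \<open>(n-1)\<close>-dimensional subspace with positive volume has Hausdorff dimension \<open>n - 1\<close> by the mass
  distribution principle.
\<close>

section \<open>Product Lebesgue measure in linear coordinates\<close>

lemma product_sigma_finite_lborel: "product_sigma_finite (\<lambda>_. lborel)"
  by standard

text \<open>Two systems of linear coordinates differ by a linear automorphism, and such maps
  preserve nullity in both directions. Only null sets are compared, so no determinant enters and
  \<open>e\<close> may be any basis.\<close>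

lemma null_sets_basis_coords:
  fixes e :: "'i \<Rightarrow> 'a::euclidean_space"
  assumes fin: "finite I" and inj: "inj_on e I" and ind: "independent (e ` I)"
    and card: "card I = DIM('a)" and N[measurable]: "N \<in> sets borel"
  shows "{t \<in> space (\<Pi>\<^sub>M i\<in>I. lborel). (\<Sum>i\<in>I. t i *\<^sub>R e i) \<in> N} \<in> null_sets (\<Pi>\<^sub>M i\<in>I. lborel)
         \<longleftrightarrow> N \<in> null_sets lborel"
proof -
  interpret product_sigma_finite "\<lambda>_. lborel :: real measure"
    by (rule product_sigma_finite_lborel)
  let ?P = "\<Pi>\<^sub>M i\<in>I. (lborel :: real measure)"
  let ?Q = "\<Pi>\<^sub>M b\<in>(Basis :: 'a set). (lborel :: real measure)"
  obtain g where g: "bij_betw g (Basis :: 'a set) I"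
    using fin card by (metis finite_Basis finite_same_card_bij)
  have gI[simp]: "g b \<in> I" if "b \<in> Basis" for b
    using g that by (auto simp: bij_betw_def)
  \<comment> \<open>Renames coordinates along the bijection \<open>g\<close>, so that the product
    over \<open>I\<close> becomes the product over \<open>Basis\<close> through which
    \<open>lborel\<close> is given.\<close>
  define \<phi> where "\<phi> = (\<lambda>t. \<lambda>b\<in>Basis. t (g b) :: real)"
  have [measurable]: "\<phi> \<in> measurable ?P ?Q"
    unfolding \<phi>_def by measurable
  have Q: "distr ?P ?Q \<phi> = ?Q"
  proof (rule PiM_eqI)
    fix A :: "'a \<Rightarrow> real set" assume A: "\<And>b. b \<in> Basis \<Longrightarrow> A b \<in> sets lborel"
    define h where "h = the_inv_into Basis g"
    have h: "bij_betw h I Basis" "\<And>b. b \<in> Basis \<Longrightarrow> h (g b) = b" "\<And>i. i \<in> I \<Longrightarrow> g (h i) = i"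
      using g bij_betw_the_inv_into[OF g] f_the_inv_into_f_bij_betw[OF g] unfolding h_def
      by (auto simp: the_inv_into_f_f bij_betw_imp_inj_on)
    have hB: "h i \<in> Basis" if "i \<in> I" for i
      using h(1) that by (auto simp: bij_betw_def)
    have "emeasure (distr ?P ?Q \<phi>) (Pi\<^sub>E Basis A) = emeasure ?P (\<phi> -` Pi\<^sub>E Basis A \<inter> space ?P)"
      using A by (intro emeasure_distr) (auto intro!: sets_PiM_I_finite)
    also have "\<phi> -` Pi\<^sub>E Basis A \<inter> space ?P = Pi\<^sub>E I (\<lambda>i. A (h i))"
    proof (intro set_eqI iffI)
      fix t assume t: "t \<in> \<phi> -` Pi\<^sub>E Basis A \<inter> space ?P"
      have "t i \<in> A (h i)" if "i \<in> I" for i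
      proof -
        have "\<phi> t (h i) \<in> A (h i)" using t hB[OF that] by (auto simp: PiE_iff)
        then show ?thesis using hB[OF that] h(3)[OF that] by (simp add: \<phi>_def)
      qed
      then show "t \<in> Pi\<^sub>E I (\<lambda>i. A (h i))" using t by (auto simp: PiE_iff space_PiM)
    next
      fix t assume t: "t \<in> Pi\<^sub>E I (\<lambda>i. A (h i))"
      have "t (g b) \<in> A b" if "b \<in> Basis" for b
        using PiE_mem[OF t gI[OF that]] h(2)[OF that] by simp
      then show "t \<in> \<phi> -` Pi\<^sub>E Basis A \<inter> space ?P"
        using t by (auto simp: PiE_iff space_PiM \<phi>_def)
    qed
    also have "emeasure ?P \<dots> = (\<Prod>i\<in>I. emeasure lborel (A (h i)))"
      using A hB fin by (intro emeasure_PiM) auto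
    also have "\<dots> = (\<Prod>b\<in>Basis. emeasure lborel (A b))"
      using prod.reindex_bij_betw[OF h(1), of "\<lambda>b. emeasure lborel (A b)"] .
    finally show "emeasure (distr ?P ?Q \<phi>) (Pi\<^sub>E Basis A) = (\<Prod>b\<in>Basis. emeasure lborel (A b))" .
  qed auto
  define f where "f = (\<lambda>x::'a. \<Sum>b\<in>Basis. (x \<bullet> b) *\<^sub>R e (g b))"
  have lin: "linear f"
    unfolding f_def by (intro linearI) (auto simp: inner_left_distrib scaleR_left_distrib
        sum.distrib scaleR_right.sum)
  have "inj f"
  proof (rule linear_injective_0[THEN iffD2, OF lin], intro allI impI)
    fix x assume "f x = 0"
    have "f x = (\<Sum>i\<in>I. (x \<bullet> the_inv_into Basis g i) *\<^sub>R e i)"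
      unfolding f_def using g
      by (subst sum.reindex_bij_betw[OF g, symmetric])
         (auto intro!: sum.cong simp: the_inv_into_f_f bij_betw_def)
    also have "\<dots> = (\<Sum>v\<in>e ` I. (x \<bullet> the_inv_into Basis g (the_inv_into I e v)) *\<^sub>R v)"
      by (subst sum.reindex[OF inj]) (simp add: the_inv_into_f_f[OF inj])
    finally have 0: "x \<bullet> the_inv_into Basis g (the_inv_into I e v) = 0" if "v \<in> e ` I" for v
      using ind that fin \<open>f x = 0\<close> by (auto simp: independent_explicit)
    have "x \<bullet> b = 0" if "b \<in> Basis" for b
      using 0[of "e (g b)"] g that
      by (auto simp: the_inv_into_f_f[OF inj] bij_betw_def the_inv_into_f_f)
    then show "x = 0" using euclidean_all_zero_iff by blast
  qed
  have "surj f" using linear_injective_imp_surjective[OF lin \<open>inj f\<close>] by simp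
  have [measurable]: "f \<in> borel_measurable borel"
    by (intro borel_measurable_continuous_onI linear_continuous_on linear_linear[THEN iffD2] lin)
  have fN: "f -` N \<in> sets borel"
    using measurable_sets[of f borel borel N] by simp
  have comp: "(\<Sum>i\<in>I. t i *\<^sub>R e i) = f (\<Sum>b\<in>Basis. \<phi> t b *\<^sub>R b)" for t
  proof -
    have "f (\<Sum>b\<in>Basis. \<phi> t b *\<^sub>R b) = (\<Sum>b\<in>Basis. t (g b) *\<^sub>R e (g b))"
      by (auto simp: f_def \<phi>_def intro!: sum.cong)
    also have "\<dots> = (\<Sum>i\<in>I. t i *\<^sub>R e i)"
      by (rule sum.reindex_bij_betw[OF g])
    finally show ?thesis by simp
  qed
  have "emeasure lborel (f -` N) = emeasure ?Q {u \<in> space ?Q. f (\<Sum>b\<in>Basis. u b *\<^sub>R b) \<in> N}"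
    by (subst lborel_eq, subst emeasure_distr)
       (auto simp: fN intro!: arg_cong[where f="emeasure _"])
  also have "\<dots> = emeasure ?P {t \<in> space ?P. (\<Sum>i\<in>I. t i *\<^sub>R e i) \<in> N}"
    by (subst Q[symmetric], subst emeasure_distr)
       (auto simp: comp \<phi>_def space_PiM intro!: arg_cong[where f="emeasure _"])
  finally have E: "emeasure lborel (f -` N) = emeasure ?P {t \<in> space ?P. (\<Sum>i\<in>I. t i *\<^sub>R e i) \<in> N}" .
  \<comment> \<open>\<open>f\<close> and its inverse are both linear, hence differentiable, and a
    differentiable map of a Euclidean space into itself keeps negligible sets negligible.\<close>
  have "f -` N \<in> null_sets lborel \<longleftrightarrow> N \<in> null_sets lborel"
  proof -
    have 1: "negligible S \<longleftrightarrow> S \<in> null_sets lborel" if "S \<in> sets borel" for S :: "'a set"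
      using that by (simp add: negligible_iff_null_sets null_sets_completion_iff)
    have image: "negligible (h ` S)" if "linear h" "negligible S" for h :: "'a \<Rightarrow> 'a" and S
      using that by (intro negligible_differentiable_image_negligible linear_imp_differentiable_on) auto
    have "linear (inv f)" using lin \<open>inj f\<close> by (rule inj_linear_imp_inv_linear)
    moreover have "N = f ` (f -` N)" "f -` N = inv f ` N"
      using \<open>surj f\<close> \<open>inj f\<close> by (simp_all add: bij_vimage_eq_inv_image bij_def image_f_inv_f)
    ultimately have "negligible N \<longleftrightarrow> negligible (f -` N)"
      using image lin by metis
    then show ?thesis using 1 fN N by simp
  qed
  moreover have "{t \<in> space ?P. (\<Sum>i\<in>I. t i *\<^sub>R e i) \<in> N} \<in> sets ?P"
    by measurable
  ultimately show ?thesis using E fN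
    by (auto simp: null_sets_def)
qed

text \<open>The product of the uniform laws has the product of the factor densities as its density
  with respect to product Lebesgue measure, so it is absolutely continuous.\<close>

lemma null_sets_PiM_uniform_measure:
  fixes I :: "'i set" and A :: "real set"
  assumes fin: "finite I" and A: "A \<in> sets borel" "emeasure lborel A \<noteq> 0" "emeasure lborel A \<noteq> \<infinity>"
    and N: "N \<in> null_sets (\<Pi>\<^sub>M i\<in>I. lborel)"
  shows "N \<in> null_sets (\<Pi>\<^sub>M i\<in>I. uniform_measure lborel A)"
proof -
  let ?U = "uniform_measure lborel A"
  have [measurable]: "A \<in> sets borel" by fact
  interpret U: prob_space ?U
    using A by (intro prob_space_uniform_measure) auto
  interpret U: product_sigma_finite "\<lambda>_::'i. ?U" by standard
  interpret L: product_sigma_finite "\<lambda>_. lborel :: real measure"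
    by (rule product_sigma_finite_lborel)
  let ?P = "\<Pi>\<^sub>M i\<in>I. (lborel :: real measure)"
  let ?d = "\<lambda>x. indicator A x / emeasure lborel A"
  have "density ?P (\<lambda>t. \<Prod>i\<in>I. ?d (t i)) = (\<Pi>\<^sub>M i\<in>I. ?U)"
  proof (rule U.PiM_eqI)
    show "sets (density ?P (\<lambda>t. \<Prod>i\<in>I. ?d (t i))) = sets (\<Pi>\<^sub>M i\<in>I. ?U)"
      by (simp, rule sets_PiM_cong) auto
    fix E assume E: "\<And>i. i \<in> I \<Longrightarrow> E i \<in> sets ?U"
    then have E': "\<And>i. i \<in> I \<Longrightarrow> E i \<in> sets borel" by simp
    have "emeasure (density ?P (\<lambda>t. \<Prod>i\<in>I. ?d (t i))) (Pi\<^sub>E I E)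
        = (\<integral>\<^sup>+t. (\<Prod>i\<in>I. ?d (t i)) * indicator (Pi\<^sub>E I E) t \<partial>?P)"
      using fin E' by (intro emeasure_density) (auto intro!: sets_PiM_I_finite)
    also have "\<dots> = (\<integral>\<^sup>+t. (\<Prod>i\<in>I. ?d (t i) * indicator (E i) (t i)) \<partial>?P)"
    proof (rule nn_integral_cong)
      fix t assume t: "t \<in> space ?P"
      have "indicator (Pi\<^sub>E I E) t = (\<Prod>i\<in>I. indicator (E i) (t i) :: ennreal)"
      proof (cases "t \<in> Pi\<^sub>E I E")
        case True then show ?thesis by (auto simp: PiE_iff intro!: prod.neutral[symmetric])
      next
        case False
        then obtain i where "i \<in> I" "t i \<notin> E i" using t by (auto simp: space_PiM PiE_iff)
        then show ?thesis using False fin by (auto intro!: prod_zero[symmetric] bexI[of _ i])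
      qed
      then show "(\<Prod>i\<in>I. ?d (t i)) * indicator (Pi\<^sub>E I E) t = (\<Prod>i\<in>I. ?d (t i) * indicator (E i) (t i))"
        by (simp only: prod.distrib)
    qed
    also have "\<dots> = (\<Prod>i\<in>I. \<integral>\<^sup>+x. ?d x * indicator (E i) x \<partial>lborel)"
      using fin E' by (intro L.product_nn_integral_prod) auto
    also have "\<dots> = (\<Prod>i\<in>I. emeasure ?U (E i))"
      using E' unfolding uniform_measure_def by (intro prod.cong refl emeasure_density[symmetric]) auto
    finally show "emeasure (density ?P (\<lambda>t. \<Prod>i\<in>I. ?d (t i))) (Pi\<^sub>E I E) = (\<Prod>i\<in>I. emeasure ?U (E i))" .
  qed (rule fin)
  moreover have "absolutely_continuous ?P (density ?P (\<lambda>t. \<Prod>i\<in>I. ?d (t i)))"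
    by (rule absolutely_continuousI_density) measurable
  ultimately show ?thesis using N by (auto simp: absolutely_continuous_def)
qed

section \<open>Lebesgue measure on a subspace\<close>

lemma sets_lborel_subspace [simp, measurable_cong]: "sets (lborel_subspace V) = sets borel"
  by (simp add: lborel_subspace_def Let_def)

lemma space_lborel_subspace [simp]: "space (lborel_subspace V) = UNIV"
  by (simp add: lborel_subspace_def Let_def)

text \<open>Hides the choice operator of the definition: later arguments only use that the measure
  comes from some orthonormal basis.\<close>

lemma lborel_subspace_basis:
  assumes "subspace V"
  obtains B where "orthonormal_basis_of V B"
    and "lborel_subspace V = distr (\<Pi>\<^sub>M b\<in>B. lborel) borel (\<lambda>t. \<Sum>b\<in>B. t b *\<^sub>R b)"
proof
  show "orthonormal_basis_of V (SOME B. orthonormal_basis_of V B)"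
    using orthonormal_basis_of_exists[OF assms] by (metis someI_ex)
qed (simp add: lborel_subspace_def Let_def)

lemma orthonormal_basis_of_independent:
  assumes "orthonormal_basis_of V B"
  shows "independent B"
  using assms pairwise_orthogonal_independent[of B]
  by (force simp: orthonormal_basis_of_def)

lemma orthonormal_basis_of_card:
  assumes "orthonormal_basis_of V B"
  shows "card B = dim V"
  using assms dim_span_eq_card_independent[OF orthonormal_basis_of_independent[OF assms]]
  by (simp add: orthonormal_basis_of_def)

lemma orthonormal_basis_of_inner_sum:
  assumes B: "orthonormal_basis_of V B" and b: "b \<in> B"
  shows "(\<Sum>c\<in>B. t c *\<^sub>R c) \<bullet> b = t b"
proof -
  have "(\<Sum>c\<in>B. t c *\<^sub>R c) \<bullet> b = (\<Sum>c\<in>B. if c = b then t b else 0)"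
    unfolding inner_sum_left
    using B b by (intro sum.cong)
      (auto simp: orthonormal_basis_of_def pairwise_def orthogonal_def norm_eq_1)
  then show ?thesis using b orthonormal_basis_of_finite[OF B] by simp
qed

lemma orthonormal_basis_of_sum_in:
  assumes "orthonormal_basis_of V B"
  shows "(\<Sum>c\<in>B. t c *\<^sub>R c) \<in> V"
proof -
  have "(\<Sum>c\<in>B. t c *\<^sub>R c) \<in> span B"
    by (intro span_sum span_scale span_base)
  then show ?thesis using assms by (simp add: orthonormal_basis_of_def)
qed

text \<open>The set is the cylinder over \<open>A\<close> in the direction of the normal
  \<open>a\<close>. In orthonormal coordinates with \<open>a\<close> as one axis, membership does
  not depend on the \<open>a\<close>-coordinate, and almost every choice of the other coordinates
  avoids \<open>A\<close>, so Fubini applies.\<close>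

lemma null_sets_lborel_subspace_hyperplane:
  fixes a :: "'a::euclidean_space"
  assumes a: "norm a = 1" and A: "A \<in> null_sets (lborel_subspace {x. a \<bullet> x = 0})"
  shows "{w. w - (a \<bullet> w) *\<^sub>R a \<in> A} \<in> null_sets lborel"
proof -
  interpret product_sigma_finite "\<lambda>_. lborel :: real measure"
    by (rule product_sigma_finite_lborel)
  define V where "V = {x. a \<bullet> x = 0}"
  have "subspace V" unfolding V_def by (rule subspace_hyperplane)
  then obtain B where B: "orthonormal_basis_of V B"
    and V: "lborel_subspace V = distr (\<Pi>\<^sub>M b\<in>B. lborel) borel (\<lambda>t. \<Sum>b\<in>B. t b *\<^sub>R b)"
    by (rule lborel_subspace_basis)
  let ?P = "\<Pi>\<^sub>M b\<in>B. (lborel :: real measure)"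
  let ?Q = "\<Pi>\<^sub>M b\<in>insert a B. (lborel :: real measure)"
  let ?N = "{w. w - (a \<bullet> w) *\<^sub>R a \<in> A}"
  have fin[simp]: "finite B" by (rule orthonormal_basis_of_finite[OF B])
  have BV: "b \<in> B \<Longrightarrow> a \<bullet> b = 0" for b
    using B by (auto simp: orthonormal_basis_of_def V_def)
  have aB[simp]: "a \<notin> B" using a BV[of a] by (auto simp: norm_eq_1)
  have [measurable]: "A \<in> sets borel" using A by (simp add: null_sets_def)
  have N[measurable]: "?N \<in> sets borel" by measurable
  have indB: "independent (insert a B)"
  proof (rule pairwise_orthogonal_independent)
    show "pairwise orthogonal (insert a B)"
      using B BV by (auto simp: orthonormal_basis_of_def pairwise_insert orthogonal_def inner_commute)
    show "0 \<notin> insert a B" using B a by (force simp: orthonormal_basis_of_def)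
  qed
  have "a \<noteq> 0" using a by auto
  have "dim V = DIM('a) - 1" unfolding V_def using dim_hyperplane[OF \<open>a \<noteq> 0\<close>] by simp
  then have card: "card (insert a B) = DIM('a)"
    using orthonormal_basis_of_card[OF B] DIM_positive[where 'a='a] by simp
  have sum_B: "a \<bullet> (\<Sum>b\<in>B. t b *\<^sub>R b) = 0" for t
    using orthonormal_basis_of_sum_in[OF B, of t] by (simp add: V_def)
  have aa: "a \<bullet> a = 1" using a by (simp add: norm_eq_1)
  have mem: "(\<Sum>b\<in>insert a B. (t(a := y)) b *\<^sub>R b) \<in> ?N \<longleftrightarrow> (\<Sum>b\<in>B. t b *\<^sub>R b) \<in> A" for t y
  proof -
    have "(\<Sum>b\<in>insert a B. (t(a := y)) b *\<^sub>R b) = y *\<^sub>R a + (\<Sum>b\<in>B. t b *\<^sub>R b)"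
      by (simp, intro sum.cong) auto
    then show ?thesis by (simp add: inner_add_right sum_B aa)
  qed
  have AE: "AE t in ?P. (\<Sum>b\<in>B. t b *\<^sub>R b) \<notin> A"
    using AE_not_in[OF A] unfolding V_def[symmetric] V by (subst (asm) AE_distr_iff) auto
  have "emeasure ?Q {t \<in> space ?Q. (\<Sum>b\<in>insert a B. t b *\<^sub>R b) \<in> ?N}
      = (\<integral>\<^sup>+t. indicator {t \<in> space ?Q. (\<Sum>b\<in>insert a B. t b *\<^sub>R b) \<in> ?N} t \<partial>?Q)"
    by (rule nn_integral_indicator[symmetric]) measurable
  also have "\<dots> = (\<integral>\<^sup>+t. indicator ?N (\<Sum>b\<in>insert a B. t b *\<^sub>R b) \<partial>?Q)"
    by (intro nn_integral_cong) (auto simp: indicator_def)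
  also have "\<dots> = (\<integral>\<^sup>+t. (\<integral>\<^sup>+y. indicator ?N (\<Sum>b\<in>insert a B. (t(a := y)) b *\<^sub>R b) \<partial>lborel) \<partial>?P)"
    by (rule product_nn_integral_insert) (simp, simp, measurable)
  also have "\<dots> = (\<integral>\<^sup>+t. (\<integral>\<^sup>+(y::real). indicator A (\<Sum>b\<in>B. t b *\<^sub>R b) \<partial>lborel) \<partial>?P)"
    using mem by (intro nn_integral_cong) (simp add: indicator_def)
  also have "\<dots> = (\<integral>\<^sup>+t. 0 \<partial>?P)"
    by (rule nn_integral_cong_AE) (use AE in \<open>auto simp: indicator_def\<close>)
  finally have "{t \<in> space ?Q. (\<Sum>b\<in>insert a B. t b *\<^sub>R b) \<in> ?N} \<in> null_sets ?Q"
    by (auto simp: null_sets_def)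
  then show ?thesis
    using null_sets_basis_coords[of "insert a B" "\<lambda>b. b" ?N] indB card by simp
qed

text \<open>In coordinates, the part of \<open>V\<close> inside \<open>U\<close> lies in a cube of
  side \<open>2 * diameter U\<close> centred at the coordinates of one point of \<open>U\<close>.
  The constant is not sharp, which is harmless for dimension estimates.\<close>

lemma emeasure_lborel_subspace_le:
  fixes U :: "'a::euclidean_space set"
  assumes "subspace V" and [measurable]: "U \<in> sets borel" and bdd: "bounded U"
  shows "emeasure (lborel_subspace V) U \<le> ennreal ((2 * diameter U) ^ dim V)"
proof (cases "U = {}")
  case False
  then obtain u where u: "u \<in> U" by auto
  interpret product_sigma_finite "\<lambda>_. lborel :: real measure"
    by (rule product_sigma_finite_lborel)
  obtain B where B: "orthonormal_basis_of V B"
    and V: "lborel_subspace V = distr (\<Pi>\<^sub>M b\<in>B. lborel) borel (\<lambda>t. \<Sum>b\<in>B. t b *\<^sub>R b)"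
    using lborel_subspace_basis[OF \<open>subspace V\<close>] .
  let ?P = "\<Pi>\<^sub>M b\<in>B. (lborel :: real measure)"
  define C where "C = (\<lambda>b. {u \<bullet> b - diameter U..u \<bullet> b + diameter U})"
  have fin[simp]: "finite B" by (rule orthonormal_basis_of_finite[OF B])
  have d: "0 \<le> diameter U" using diameter_ge_0[OF bdd] .
  have "emeasure (lborel_subspace V) U
      = emeasure ?P ((\<lambda>t. \<Sum>b\<in>B. t b *\<^sub>R b) -` U \<inter> space ?P)"
    unfolding V by (rule emeasure_distr) auto
  also have "\<dots> \<le> emeasure ?P (Pi\<^sub>E B C)"
  proof (rule emeasure_mono)
    show "(\<lambda>t. \<Sum>b\<in>B. t b *\<^sub>R b) -` U \<inter> space ?P \<subseteq> Pi\<^sub>E B C"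
    proof
      fix t assume t: "t \<in> (\<lambda>t. \<Sum>b\<in>B. t b *\<^sub>R b) -` U \<inter> space ?P"
      have "t b \<in> C b" if b: "b \<in> B" for b
      proof -
        let ?x = "\<Sum>b\<in>B. t b *\<^sub>R b"
        have "norm b = 1" using B b by (auto simp: orthonormal_basis_of_def)
        have "\<bar>t b - u \<bullet> b\<bar> = \<bar>(?x - u) \<bullet> b\<bar>"
          by (simp add: inner_diff_left orthonormal_basis_of_inner_sum[OF B b])
        also have "\<dots> \<le> norm (?x - u)"
          using Cauchy_Schwarz_ineq2[of "?x - u" b] \<open>norm b = 1\<close> by simp
        also have "\<dots> \<le> diameter U"
          using diameter_bounded_bound[OF bdd, of ?x u] t u by (simp add: dist_norm)
        finally show ?thesis unfolding C_def by (simp add: abs_le_iff)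
      qed
      then show "t \<in> Pi\<^sub>E B C" using t by (auto simp: space_PiM PiE_iff)
    qed
    show "Pi\<^sub>E B C \<in> sets ?P" by (rule sets_PiM_I_finite) (auto simp: C_def)
  qed
  also have "\<dots> = (\<Prod>b\<in>B. emeasure lborel (C b))"
    by (rule emeasure_PiM) (auto simp: C_def)
  also have "\<dots> = (\<Prod>b\<in>B. ennreal (2 * diameter U))"
    using d by (intro prod.cong) (auto simp: C_def)
  also have "\<dots> = ennreal ((2 * diameter U) ^ dim V)"
    using d by (simp add: orthonormal_basis_of_card[OF B] ennreal_power)
  finally show ?thesis .
qed simp

section \<open>Hausdorff dimension and supports\<close>

lemma diameter_le_bounded:
  fixes S :: "'a::real_normed_vector set"
  assumes "0 \<le> d" and "\<And>x y. x \<in> S \<Longrightarrow> y \<in> S \<Longrightarrow> norm (x - y) \<le> d"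
  shows "bounded S \<and> diameter S \<le> d"
proof
  show "bounded S"
    unfolding bounded_def dist_norm using assms(2) by (metis all_not_in_conv)
  show "diameter S \<le> d"
    using assms by (intro diameter_le) auto
qed

text \<open>Cutting the coordinate cube \<open>[-R, R]\<close> into cells of side
  \<open>2 * R / N\<close> gives an explicit cover. The diameter of a cell is bounded by the sum of
  its sides, one for each basis vector.\<close>

lemma hausdorff_premeasure_le_grid:
  fixes A :: "'a::euclidean_space set" and N :: nat
  assumes V: "subspace V" and AV: "A \<subseteq> V" and R: "0 < R" "\<And>x. x \<in> A \<Longrightarrow> norm x \<le> R"
    and N: "0 < N" and s: "0 \<le> s" and \<delta>: "real (dim V) * (2 * R / real N) \<le> \<delta>"
  shows "hausdorff_premeasure s \<delta> A
    \<le> ennreal (real ((N + 1) ^ dim V) * (real (dim V) * (2 * R / real N)) powr s)"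
proof -
  obtain B where B: "orthonormal_basis_of V B"
    using orthonormal_basis_of_exists[OF V] .
  have fin[simp]: "finite B" by (rule orthonormal_basis_of_finite[OF B])
  have normB: "norm b = 1" if "b \<in> B" for b using B that by (auto simp: orthonormal_basis_of_def)
  have d: "card B = dim V" by (rule orthonormal_basis_of_card[OF B])
  define h where "h = 2 * R / real N"
  have h: "0 < h" using R N by (simp add: h_def)
  define D where "D = real (dim V) * h"
  define cell where "cell = (\<lambda>p :: 'a \<Rightarrow> nat. (\<lambda>t. \<Sum>b\<in>B. t b *\<^sub>R b) `
      {t. \<forall>b\<in>B. t b \<in> {real (p b) * h - R .. real (p b + 1) * h - R}})"
  \<comment> \<open>Indices run up to \<open>N\<close> inclusive: the coordinate \<open>R\<close>
    itself has floor index \<open>N\<close>, hence \<open>N + 1\<close> cells per axis.\<close>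
  define P where "P = Pi\<^sub>E B (\<lambda>_. {..N})"
  have finP: "finite P" and cardP: "card P = (N + 1) ^ dim V"
    by (auto simp: P_def card_PiE finite_PiE d)
  have D0: "0 \<le> D" using h by (simp add: D_def)
  have cell: "bounded (cell p) \<and> diameter (cell p) \<le> D" for p
  proof (rule diameter_le_bounded[OF D0])
    fix x y assume "x \<in> cell p" "y \<in> cell p"
    then obtain t u where tu: "x = (\<Sum>b\<in>B. t b *\<^sub>R b)" "y = (\<Sum>b\<in>B. u b *\<^sub>R b)"
      and *: "\<And>b. b \<in> B \<Longrightarrow> t b \<in> {real (p b) * h - R .. real (p b + 1) * h - R}"
       "\<And>b. b \<in> B \<Longrightarrow> u b \<in> {real (p b) * h - R .. real (p b + 1) * h - R}"
      by (auto simp: cell_def)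
    have "x - y = (\<Sum>b\<in>B. (t b - u b) *\<^sub>R b)"
      by (simp add: tu sum_subtractf scaleR_diff_left)
    then have "norm (x - y) \<le> (\<Sum>b\<in>B. norm ((t b - u b) *\<^sub>R b))"
      by (simp only: norm_sum)
    also have "\<dots> \<le> (\<Sum>b\<in>B. h)"
    proof (rule sum_mono)
      fix b assume b: "b \<in> B"
      have "\<bar>t b - u b\<bar> \<le> h" using *[OF b] by (auto simp: abs_le_iff algebra_simps)
      then show "norm ((t b - u b) *\<^sub>R b) \<le> h" using normB[OF b] by simp
    qed
    finally show "norm (x - y) \<le> D" by (simp add: D_def d)
  qed
  have cover: "\<exists>p\<in>P. x \<in> cell p" if x: "x \<in> A" for x
  proof -
    have "x \<in> span B" using B AV x by (auto simp: orthonormal_basis_of_def)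
    then obtain t where t: "x = (\<Sum>b\<in>B. t b *\<^sub>R b)"
      by (auto simp: span_finite)
    define p where "p = (\<lambda>b\<in>B. nat \<lfloor>(t b + R) / h\<rfloor>)"
    have tR: "\<bar>t b\<bar> \<le> R" if "b \<in> B" for b
      using orthonormal_basis_of_inner_sum[OF B that, of t] Cauchy_Schwarz_ineq2[of x b]
        normB[OF that] R(2)[OF x] t by simp
    have fl: "0 \<le> (t b + R) / h" "(t b + R) / h \<le> real N" if "b \<in> B" for b
    proof -
      have "0 \<le> t b + R" "t b + R \<le> 2 * R" "real N * h = 2 * R"
        using tR[OF that] N by (auto simp: abs_le_iff h_def)
      then show "0 \<le> (t b + R) / h" "(t b + R) / h \<le> real N"
        using h by (simp_all add: pos_divide_le_eq)
    qed
    have "p b \<in> {..N}" if "b \<in> B" for b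
      using fl[OF that] that by (simp add: p_def nat_le_iff floor_le_iff)
    then have "p \<in> P" by (auto simp: P_def p_def)
    moreover have "x \<in> cell p"
    proof -
      have "t b \<in> {real (p b) * h - R .. real (p b + 1) * h - R}" if b: "b \<in> B" for b
      proof -
        have "real (p b) = of_int \<lfloor>(t b + R) / h\<rfloor>" using fl[OF b] b by (simp add: p_def)
        then have "real (p b) \<le> (t b + R) / h" "(t b + R) / h \<le> real (p b + 1)"
          by linarith+
        then show ?thesis using h by (auto simp: field_simps)
      qed
      then show ?thesis unfolding cell_def t by blast
    qed
    ultimately show ?thesis by blast
  qed
  obtain e where e: "bij_betw e {0..<card P} P"
    using ex_bij_betw_nat_finite[OF finP] by auto
  \<comment> \<open>Covers are sequences, so the finite family is padded with empty sets, whose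
    terms are \<open>0 powr s = 0\<close>.\<close>
  define U where "U = (\<lambda>i. if i < card P then cell (e i) else {})"
  have "A \<subseteq> (\<Union>i. U i)"
  proof
    fix x assume "x \<in> A"
    then obtain p where p: "p \<in> P" "x \<in> cell p" using cover by blast
    then have "p \<in> e ` {0..<card P}" using e by (simp add: bij_betw_def)
    then obtain i where "i < card P" "p = e i" by auto
    then show "x \<in> (\<Union>i. U i)" using p by (auto simp: U_def)
  qed
  moreover have "bounded (U i) \<and> diameter (U i) \<le> \<delta>" for i
    using cell[of "e i"] \<delta> D0 by (auto simp: U_def D_def h_def)
  ultimately have "hausdorff_premeasure s \<delta> A \<le> (\<Sum>i. ennreal (diameter (U i) powr s))"
    unfolding hausdorff_premeasure_def by (intro INF_lower) auto
  also have "\<dots> = (\<Sum>i<card P. ennreal (diameter (U i) powr s))"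
    by (rule suminf_finite) (auto simp: U_def)
  also have "\<dots> \<le> (\<Sum>i<card P. ennreal (D powr s))"
    using cell s
    by (intro sum_mono ennreal_leI powr_mono2) (auto simp: U_def diameter_ge_0)
  also have "\<dots> = ennreal (real ((N + 1) ^ dim V) * D powr s)"
    by (simp add: cardP ennreal_mult ennreal_of_nat_eq_real_of_nat)
  finally show ?thesis by (simp add: D_def h_def)
qed

text \<open>With \<open>d = dim V\<close>, the grid with parameter \<open>N\<close> costs at most a
  constant times \<open>N powr (d - s)\<close>, which tends to 0 because \<open>s > d\<close>. For
  each fixed \<open>\<delta>\<close> the grids are eventually fine enough.\<close>

lemma hausdorff_measure_bounded_subspace_eq_0:
  fixes A :: "'a::euclidean_space set"
  assumes V: "subspace V" and AV: "A \<subseteq> V" and "bounded A" and s: "real (dim V) < s"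
  shows "hausdorff_measure s A = 0"
proof -
  obtain R where R: "0 < R" "\<And>x. x \<in> A \<Longrightarrow> norm x \<le> R"
    using \<open>bounded A\<close> bounded_pos by blast
  have s0: "0 \<le> s" using s by linarith
  define d where "d = dim V"
  define K where "K = real d * (2 * R)"
  have K0: "0 \<le> K" using R by (simp add: K_def)
  have "hausdorff_premeasure s \<delta> A = 0" if \<delta>: "0 < \<delta>" for \<delta>
  proof -
    have lim: "(\<lambda>N::nat. 2 ^ d * K powr s * real N powr (real d - s)) \<longlonglongrightarrow> 0"
    proof -
      have "(\<lambda>N::nat. real N powr (real d - s)) \<longlonglongrightarrow> 0"
        using s unfolding d_def by (intro tendsto_neg_powr filterlim_real_sequentially) auto
      from tendsto_mult_left_zero[OF this, of "2 ^ d * K powr s"] show ?thesis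
        by (simp add: mult.commute tendsto_mult_right_zero)
    qed
    have "(\<lambda>N::nat. K / real N) \<longlonglongrightarrow> 0" by (rule lim_const_over_n)
    then have ev: "\<forall>\<^sub>F N::nat in sequentially. K / real N < \<delta>"
      using \<delta> by (rule order_tendstoD)
    have "\<forall>\<^sub>F N in sequentially. hausdorff_premeasure s \<delta> A
        \<le> ennreal (2 ^ d * K powr s * real N powr (real d - s))"
      using ev eventually_gt_at_top[of 0]
    proof eventually_elim
      case (elim N)
      have "hausdorff_premeasure s \<delta> A \<le> ennreal (real ((N + 1) ^ d) * (K / real N) powr s)"
        using hausdorff_premeasure_le_grid[OF V AV R, of N s \<delta>] elim s0
        by (simp add: K_def d_def)
      also have "\<dots> \<le> ennreal (2 ^ d * K powr s * real N powr (real d - s))"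
      proof (rule ennreal_leI)
        \<comment> \<open>\<open>N + 1 \<le> 2 * N\<close> for positive \<open>N\<close> turns the
          cell count into a pure power of \<open>N\<close>; this is the source of the factor
          \<open>2 ^ d\<close>.\<close>
        have "real ((N + 1) ^ d) \<le> (2 * real N) ^ d"
          using elim unfolding of_nat_power by (intro power_mono) auto
        also have "\<dots> = 2 ^ d * real N powr real d"
          using elim by (simp add: power_mult_distrib powr_realpow)
        finally have "real ((N + 1) ^ d) \<le> 2 ^ d * real N powr real d" .
        then have "real ((N + 1) ^ d) * (K / real N) powr s
           \<le> (2 ^ d * real N powr real d) * (K powr s / real N powr s)"
          using mult_right_mono[of "real ((N + 1) ^ d)" _ "K powr s / real N powr s"] K0
          by (simp add: powr_divide)
        also have "\<dots> = 2 ^ d * K powr s * real N powr (real d - s)"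
          by (simp add: powr_diff)
        finally show "real ((N + 1) ^ d) * (K / real N) powr s
          \<le> 2 ^ d * K powr s * real N powr (real d - s)" .
      qed
      finally show ?case .
    qed
    moreover have "(\<lambda>N. ennreal (2 ^ d * K powr s * real N powr (real d - s))) \<longlonglongrightarrow> ennreal 0"
      by (intro tendsto_ennrealI lim)
    ultimately have "hausdorff_premeasure s \<delta> A \<le> ennreal 0"
      by (intro tendsto_lowerbound[of _ _ sequentially]) auto
    then show ?thesis by simp
  qed
  then show ?thesis
    unfolding hausdorff_measure_def by (subst SUP_cong[OF refl, of _ _ "\<lambda>_. 0"]) auto
qed

text \<open>Mass distribution principle: a covering set of diameter at most 1 has volume at most
  \<open>2 ^ dim V\<close> times the \<open>s\<close>-th power of its diameter, and summing over the
  cover bounds the volume of \<open>A\<close>. Scale 1 is enough, since the Hausdorff measure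
  dominates the premeasure at every scale.\<close>

lemma emeasure_lborel_subspace_le_hausdorff_measure:
  fixes A :: "'a::euclidean_space set"
  assumes V: "subspace V" and A: "A \<in> sets borel" and s: "s \<le> real (dim V)" "0 < dim V"
  shows "emeasure (lborel_subspace V) A \<le> ennreal (2 ^ dim V) * hausdorff_measure s A"
proof -
  have pre: "emeasure (lborel_subspace V) A \<le> ennreal (2 ^ dim V) * (\<Sum>i. ennreal (diameter (U i) powr s))"
    if U: "A \<subseteq> (\<Union>i. U i)" "\<And>i. bounded (U i)" "\<And>i. diameter (U i) \<le> 1" for U :: "nat \<Rightarrow> 'a set"
  proof -
    \<comment> \<open>Covering sets are arbitrary, so they are replaced by their closures, which are
      Borel and have the same diameter.\<close>
    have "emeasure (lborel_subspace V) A \<le> emeasure (lborel_subspace V) (\<Union>i. closure (U i))"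
    proof (rule emeasure_mono)
      show "A \<subseteq> (\<Union>i. closure (U i))"
        using U(1) closure_subset[of "U _"] by blast
    qed simp
    also have "\<dots> \<le> (\<Sum>i. emeasure (lborel_subspace V) (closure (U i)))"
      by (rule emeasure_subadditive_countably) auto
    also have "\<dots> \<le> (\<Sum>i. ennreal (2 ^ dim V) * ennreal (diameter (U i) powr s))"
    proof (rule suminf_le)
      fix i
      let ?d = "diameter (U i)"
      have d0: "0 \<le> ?d" using U(2) by (rule diameter_ge_0)
      \<comment> \<open>On (0, 1] a larger exponent gives a smaller power. At diameter 0 both sides
        vanish, the left one because \<open>0 < dim V\<close>.\<close>
      have "?d ^ dim V \<le> ?d powr s"
      proof (cases "?d = 0")
        case False
        then have "?d ^ dim V = ?d powr real (dim V)" using d0 by (simp add: powr_realpow)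
        also have "\<dots> \<le> ?d powr s" using U(3)[of i] d0 s(1) False
          by (intro powr_mono') auto
        finally show ?thesis .
      qed (use s in \<open>auto simp: zero_power\<close>)
      then have "(2 * ?d) ^ dim V \<le> 2 ^ dim V * ?d powr s"
        by (simp add: power_mult_distrib)
      moreover have "emeasure (lborel_subspace V) (closure (U i)) \<le> ennreal ((2 * ?d) ^ dim V)"
        using emeasure_lborel_subspace_le[OF V, of "closure (U i)"] U(2)[of i] bounded_closure[of "U i"]
        by (simp add: diameter_closure)
      ultimately have "emeasure (lborel_subspace V) (closure (U i)) \<le> ennreal (2 ^ dim V * ?d powr s)"
        by (meson ennreal_leI order_trans)
      then show "emeasure (lborel_subspace V) (closure (U i))
          \<le> ennreal (2 ^ dim V) * ennreal (?d powr s)"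
        by (simp add: ennreal_mult)
    qed auto
    finally show ?thesis by simp
  qed
  have "emeasure (lborel_subspace V) A / ennreal (2 ^ dim V) \<le> hausdorff_premeasure s 1 A"
    unfolding hausdorff_premeasure_def
  proof (rule INF_greatest)
    fix U :: "nat \<Rightarrow> 'a set"
    assume "U \<in> {U. A \<subseteq> (\<Union>i. U i) \<and> (\<forall>i. bounded (U i) \<and> diameter (U i) \<le> 1)}"
    then have "emeasure (lborel_subspace V) A \<le> ennreal (2 ^ dim V) * (\<Sum>i. ennreal (diameter (U i) powr s))"
      by (intro pre) auto
    then have "emeasure (lborel_subspace V) A / ennreal (2 ^ dim V)
       \<le> (ennreal (2 ^ dim V) * (\<Sum>i. ennreal (diameter (U i) powr s))) / ennreal (2 ^ dim V)"
      by (rule divide_right_mono_ennreal)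
    also have "\<dots> = (\<Sum>i. ennreal (diameter (U i) powr s))"
      by (subst mult.commute, rule ennreal_mult_divide_eq) auto
    finally show "emeasure (lborel_subspace V) A / ennreal (2 ^ dim V)
       \<le> (\<Sum>i. ennreal (diameter (U i) powr s))" .
  qed
  also have "\<dots> \<le> hausdorff_measure s A"
    unfolding hausdorff_measure_def by (intro SUP_upper) auto
  finally have "ennreal (2 ^ dim V) * (emeasure (lborel_subspace V) A / ennreal (2 ^ dim V))
     \<le> ennreal (2 ^ dim V) * hausdorff_measure s A"
    by (rule mult_left_mono) simp
  then show ?thesis
    by (subst (asm) ennreal_times_divide, subst (asm) mult.commute, subst (asm) ennreal_mult_divide_eq) auto
qed

text \<open>Positive volume rules out every exponent below \<open>dim V\<close>, and the grid covers
  admit every exponent above it. At \<open>dim V\<close> itself the Hausdorff measure is still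
  positive, so the infimum is approached through \<open>dim V + e\<close>.\<close>

lemma hausdorff_dim_eq_dim_subspace:
  fixes A :: "'a::euclidean_space set"
  assumes V: "subspace V" "0 < dim V" and A: "A \<in> sets borel" "A \<subseteq> V" "bounded A"
    and pos: "emeasure (lborel_subspace V) A \<noteq> 0"
  shows "hausdorff_dim A = of_nat (dim V)"
proof (rule antisym)
  have ge: "real (dim V) \<le> s" if "hausdorff_measure s A = 0" for s
  proof (rule ccontr)
    assume "\<not> real (dim V) \<le> s"
    then have "emeasure (lborel_subspace V) A \<le> ennreal (2 ^ dim V) * hausdorff_measure s A"
      by (intro emeasure_lborel_subspace_le_hausdorff_measure V A) simp
    then show False using pos that by simp
  qed
  show "of_nat (dim V) \<le> hausdorff_dim A"
    unfolding hausdorff_dim_def ennreal_of_nat_eq_real_of_nat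
    by (intro INF_greatest ennreal_leI) (auto intro: ge)
  have "hausdorff_dim A \<le> ennreal (real (dim V)) + ennreal e" if "0 < e" for e
  proof -
    have "hausdorff_dim A \<le> ennreal (real (dim V) + e)"
      unfolding hausdorff_dim_def
      using hausdorff_measure_bounded_subspace_eq_0[OF V(1) A(2,3), of "real (dim V) + e"] that
      by (intro INF_lower) auto
    then show ?thesis using that by (simp add: ennreal_plus)
  qed
  then show "hausdorff_dim A \<le> of_nat (dim V)"
    unfolding ennreal_of_nat_eq_real_of_nat
    by (rule ennreal_le_epsilon)
qed

section \<open>Supports of Borel measures\<close>

lemma closed_measure_support: "closed (measure_support N)"
proof -
  have "- measure_support N = \<Union>{U. open U \<and> emeasure N U = 0}"
    by (auto simp: measure_support_def)
  then show ?thesis by (simp add: closed_def open_Union)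
qed

text \<open>By second countability the complement of the support is covered by countably many basic
  open sets of measure 0.\<close>

lemma AE_in_measure_support:
  fixes N :: "'a::second_countable_topology measure"
  assumes sets[simp]: "sets N = sets borel"
  shows "AE x in N. x \<in> measure_support N"
proof -
  obtain B :: "'a set set" where B: "countable B" "topological_basis B"
    using ex_countable_basis by auto
  define B0 where "B0 = {b \<in> B. emeasure N b = 0}"
  have "- measure_support N \<subseteq> \<Union>B0"
  proof
    fix x assume "x \<in> - measure_support N"
    then obtain U where "open U" "x \<in> U" and U: "emeasure N U = 0"
      by (auto simp: measure_support_def)
    then obtain b where b: "b \<in> B" "x \<in> b" "b \<subseteq> U"
      using topological_basisE[OF B(2)] by metis
    then have "emeasure N b = 0"
      using emeasure_mono[OF b(3), of N] \<open>open U\<close> U by simp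
    then show "x \<in> \<Union>B0" using b by (auto simp: B0_def)
  qed
  moreover have "\<Union>B0 \<in> null_sets N"
  proof -
    have "b \<in> null_sets N" if "b \<in> B0" for b
      using that topological_basis_open[OF B(2)] by (auto simp: B0_def null_sets_def)
    then show ?thesis
      using null_sets_UN'[of B0 "\<lambda>b. b" N] B(1) by (auto simp: B0_def)
  qed
  ultimately show ?thesis
    by (intro AE_I'[of "\<Union>B0"]) auto
qed

lemma measure_support_subset:
  assumes "closed C" "emeasure N (- C) = 0"
  shows "measure_support N \<subseteq> C"
  using assms by (auto simp: measure_support_def open_Compl)

section \<open>The marginal distributions\<close>

lemma nn_integral_uniform_Icc:
  assumes [measurable]: "f \<in> borel_measurable borel"
  shows "(\<integral>\<^sup>+x. f x \<partial>uniform_measure lborel {-1..1::real})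
       = ennreal (1 / 2) * (\<integral>\<^sup>+x. f x * indicator {-1..1} x \<partial>lborel)"
proof -
  have "inverse (emeasure lborel {-1..1::real}) = ennreal (1 / 2)"
    by (simp add: inverse_ennreal[symmetric])
  then show ?thesis
    by (subst nn_integral_uniform_measure) (auto simp: divide_ennreal_def mult.commute)
qed

text \<open>Fubini and the shift \<open>x = x' + s\<close> leave, for each \<open>s\<close>, the
  length of the overlap of \<open>[-1, 1]\<close> with its translate by \<open>-s\<close>. Up to the
  normalisation 1/4 this is the triangular density of a difference of two uniform variables.\<close>

lemma nn_integral_difference_Icc:
  fixes G :: "real \<Rightarrow> ennreal"
  assumes [measurable]: "G \<in> borel_measurable borel"
  shows "(\<integral>\<^sup>+x. (\<integral>\<^sup>+x'. G (x - x') * indicator {-1..1} x' \<partial>lborel) * indicator {-1..1} x \<partial>lborel)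
       = (\<integral>\<^sup>+s. G s * ennreal (max 0 (2 - \<bar>s\<bar>)) \<partial>lborel)"
proof -
  have "(\<integral>\<^sup>+x. (\<integral>\<^sup>+x'. G (x - x') * indicator {-1..1} x' \<partial>lborel) * indicator {-1..1} x \<partial>lborel)
      = (\<integral>\<^sup>+x. (\<integral>\<^sup>+x'. G (x - x') * indicator {-1..1} x' * indicator {-1..1} x \<partial>lborel) \<partial>lborel)"
    by (simp add: nn_integral_multc)
  also have "\<dots> = (\<integral>\<^sup>+x'. (\<integral>\<^sup>+x. G (x - x') * indicator {-1..1} x' * indicator {-1..1} x \<partial>lborel) \<partial>lborel)"
    by (rule lborel_pair.Fubini') measurable
  also have "\<dots> = (\<integral>\<^sup>+x'. (\<integral>\<^sup>+s. G s * indicator {-1..1} x' * indicator {-1..1} (x' + s) \<partial>lborel) \<partial>lborel)"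
  proof (rule nn_integral_cong)
    fix x' :: real
    show "(\<integral>\<^sup>+x. G (x - x') * indicator {-1..1} x' * indicator {-1..1} x \<partial>lborel)
        = (\<integral>\<^sup>+s. G s * indicator {-1..1} x' * indicator {-1..1} (x' + s) \<partial>lborel)"
      using nn_integral_real_affine[of "\<lambda>x. G (x - x') * indicator {-1..1} x' * indicator {-1..1} x" 1 x']
      by simp
  qed
  also have "\<dots> = (\<integral>\<^sup>+s. (\<integral>\<^sup>+x'. G s * indicator {-1..1} x' * indicator {-1..1} (x' + s) \<partial>lborel) \<partial>lborel)"
    by (rule lborel_pair.Fubini') measurable
  also have "\<dots> = (\<integral>\<^sup>+s. G s * ennreal (max 0 (2 - \<bar>s\<bar>)) \<partial>lborel)"
  proof (rule nn_integral_cong)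
    fix s :: real
    have "(\<integral>\<^sup>+x'. G s * indicator {-1..1} x' * indicator {-1..1} (x' + s) \<partial>lborel)
        = (\<integral>\<^sup>+x'. G s * indicator {max (-1) (-1 - s)..min 1 (1 - s)} x' \<partial>lborel)"
      by (intro nn_integral_cong) (auto simp: indicator_def)
    also have "\<dots> = G s * emeasure lborel {max (-1) (-1 - s)..min 1 (1 - s)}"
      by (rule nn_integral_cmult_indicator) auto
    also have "emeasure lborel {max (-1) (-1 - s)..min 1 (1 - s)} = ennreal (max 0 (2 - \<bar>s\<bar>))"
      by (auto simp: emeasure_lborel_Icc_eq max_def min_def)
    finally show "(\<integral>\<^sup>+x'. G s * indicator {-1..1} x' * indicator {-1..1} (x' + s) \<partial>lborel)
      = G s * ennreal (max 0 (2 - \<bar>s\<bar>))" .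
  qed
  finally show ?thesis .
qed

text \<open>The change of variables \<open>y = s / 2 + c * t\<close> has Jacobian
  \<open>1 - \<bar>s\<bar> / 2\<close>, half of the factor \<open>2 - \<bar>s\<bar>\<close>; this
  explains the 2 on the right. At \<open>\<bar>s\<bar> = 2\<close> the map is constant and the
  substitution breaks down.\<close>

lemma nn_integral_segment_Icc:
  fixes g :: "real \<Rightarrow> ennreal"
  assumes [measurable]: "g \<in> borel_measurable borel" and \<sigma>: "\<bar>\<sigma>\<bar> = 1" and s: "\<bar>s\<bar> \<noteq> 2"
  shows "(\<integral>\<^sup>+t. g (s / 2 + \<sigma> * (1 - \<bar>s\<bar> / 2) * t) * indicator {-1..1} t \<partial>lborel) * ennreal (max 0 (2 - \<bar>s\<bar>))
       = 2 * (\<integral>\<^sup>+y. g y * indicator {-1..1} y * indicator {y - 1..y + 1} s \<partial>lborel)"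
proof (cases "\<bar>s\<bar> < 2")
  case True
  define c where "c = \<sigma> * (1 - \<bar>s\<bar> / 2)"
  have c: "\<bar>c\<bar> = 1 - \<bar>s\<bar> / 2" using \<sigma> True by (simp add: c_def abs_mult)
  then have "c \<noteq> 0" using True by auto
  \<comment> \<open>The intersection of \<open>[-1, 1]\<close> and \<open>[s - 1, s + 1]\<close> is
    the interval with centre \<open>s / 2\<close> and half-length
    \<open>\<bar>c\<bar>\<close>.\<close>
  have ind: "indicator {-1..1} t = (indicator {-1..1} (s / 2 + c * t) * indicator {s / 2 + c * t - 1..s / 2 + c * t + 1} s :: ennreal)" for t
  proof -
    have "\<bar>t\<bar> \<le> 1 \<longleftrightarrow> \<bar>c * t\<bar> \<le> \<bar>c\<bar>"
      using \<open>c \<noteq> 0\<close> by (simp add: abs_mult)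
    also have "\<dots> \<longleftrightarrow> \<bar>s / 2 + c * t\<bar> \<le> 1 \<and> \<bar>s / 2 + c * t - s\<bar> \<le> 1"
      unfolding c by linarith
    finally show ?thesis by (auto simp: indicator_def abs_le_iff)
  qed
  have "(\<integral>\<^sup>+y. g y * indicator {-1..1} y * indicator {y - 1..y + 1} s \<partial>lborel)
     = ennreal \<bar>c\<bar> * (\<integral>\<^sup>+t. g (s / 2 + c * t) * indicator {-1..1} (s / 2 + c * t)
          * indicator {s / 2 + c * t - 1..s / 2 + c * t + 1} s \<partial>lborel)"
    by (rule nn_integral_real_affine[OF _ \<open>c \<noteq> 0\<close>]) (simp add: indicator_def[abs_def])
  also have "\<dots> = ennreal \<bar>c\<bar> * (\<integral>\<^sup>+t. g (s / 2 + c * t) * indicator {-1..1} t \<partial>lborel)"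
    unfolding mult.assoc ind[symmetric] ..
  finally have "2 * (\<integral>\<^sup>+y. g y * indicator {-1..1} y * indicator {y - 1..y + 1} s \<partial>lborel)
     = ennreal (2 * \<bar>c\<bar>) * (\<integral>\<^sup>+t. g (s / 2 + c * t) * indicator {-1..1} t \<partial>lborel)"
    by (simp add: ennreal_mult mult.assoc)
  moreover have "2 * \<bar>c\<bar> = max 0 (2 - \<bar>s\<bar>)" using c True by simp
  ultimately show ?thesis by (simp add: c_def mult.commute)
next
  case False
  \<comment> \<open>For \<open>\<bar>s\<bar> > 2\<close> the two intervals are disjoint, and both
    sides are 0.\<close>
  then have zero: "g y * indicator {-1..1} y * indicator {y - 1..y + 1} s = 0" for y
    using s by (auto simp: indicator_def)
  show ?thesis unfolding zero using False by simp
qed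

text \<open>The constants balance: three uniform densities contribute 1/8, the change of variables
  and the length of the \<open>s\<close>-sections contribute 2 each, and the uniform density 1/2
  remains.\<close>

lemma nn_integral_pair_sum_uniform:
  fixes g :: "real \<Rightarrow> ennreal"
  assumes g[measurable]: "g \<in> borel_measurable borel" and \<sigma>: "\<bar>\<sigma>\<bar> = 1"
  defines "U \<equiv> uniform_measure lborel {-1..1::real}"
  shows "(\<integral>\<^sup>+x. \<integral>\<^sup>+x'. \<integral>\<^sup>+t. g ((x - x') / 2 + \<sigma> * (1 - \<bar>x - x'\<bar> / 2) * t) \<partial>U \<partial>U \<partial>U)
       = (\<integral>\<^sup>+y. g y \<partial>U)"
proof -
  define G where "G = (\<lambda>s. \<integral>\<^sup>+t. g (s / 2 + \<sigma> * (1 - \<bar>s\<bar> / 2) * t) * indicator {-1..1} t \<partial>lborel)"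
  have [measurable]: "G \<in> borel_measurable borel"
    unfolding G_def by measurable
  have sq: "AE s in lborel. \<bar>s::real\<bar> \<noteq> 2"
    using AE_lborel_singleton[of 2] AE_lborel_singleton[of "-2"] by eventually_elim auto
  have "(\<integral>\<^sup>+s. G s * ennreal (max 0 (2 - \<bar>s\<bar>)) \<partial>lborel)
      = (\<integral>\<^sup>+s. 2 * (\<integral>\<^sup>+y. g y * indicator {-1..1} y * indicator {y - 1..y + 1} s \<partial>lborel) \<partial>lborel)"
    using sq by (intro nn_integral_cong_AE, eventually_elim)
      (unfold G_def, rule nn_integral_segment_Icc[OF g \<sigma>])
  also have "\<dots> = 2 * (\<integral>\<^sup>+s. (\<integral>\<^sup>+y. g y * indicator {-1..1} y * indicator {y - 1..y + 1} s \<partial>lborel) \<partial>lborel)"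
    by (rule nn_integral_cmult) (simp add: indicator_def[abs_def])
  also have "(\<integral>\<^sup>+s. (\<integral>\<^sup>+y. g y * indicator {-1..1} y * indicator {y - 1..y + 1} s \<partial>lborel) \<partial>lborel)
     = (\<integral>\<^sup>+y. (\<integral>\<^sup>+s. g y * indicator {-1..1} y * indicator {y - 1..y + 1} s \<partial>lborel) \<partial>lborel)"
    by (rule lborel_pair.Fubini') (simp add: indicator_def[abs_def])
  \<comment> \<open>Over each \<open>y\<close> in \<open>[-1, 1]\<close> the variable
    \<open>s\<close> ranges over an interval of length 2, whatever \<open>y\<close> is; this makes
    the marginal uniform.\<close>
  also have "\<dots> = (\<integral>\<^sup>+y. (g y * indicator {-1..1} y) * 2 \<partial>lborel)"
    by (intro nn_integral_cong) (subst nn_integral_cmult_indicator, auto)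
  also have "\<dots> = (\<integral>\<^sup>+y. g y * indicator {-1..1} y \<partial>lborel) * 2"
    by (rule nn_integral_multc) measurable
  finally have E: "(\<integral>\<^sup>+s. G s * ennreal (max 0 (2 - \<bar>s\<bar>)) \<partial>lborel)
     = 4 * (\<integral>\<^sup>+y. g y * indicator {-1..1} y \<partial>lborel)"
    by (simp add: mult.commute mult.assoc[symmetric])
  have inner: "(\<integral>\<^sup>+t. g (s / 2 + \<sigma> * (1 - \<bar>s\<bar> / 2) * t) \<partial>U) = ennreal (1 / 2) * G s" for s
    unfolding G_def U_def by (rule nn_integral_uniform_Icc) measurable
  define H where "H = (\<lambda>x. \<integral>\<^sup>+x'. G (x - x') * indicator {-1..1} x' \<partial>lborel)"
  have [measurable]: "H \<in> borel_measurable borel"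
    unfolding H_def by measurable
  have middle: "(\<integral>\<^sup>+x'. ennreal (1 / 2) * G (x - x') \<partial>U) = ennreal (1 / 4) * H x" for x
  proof -
    have "(\<integral>\<^sup>+x'. ennreal (1 / 2) * G (x - x') \<partial>U) = ennreal (1 / 2) * (\<integral>\<^sup>+x'. G (x - x') \<partial>U)"
      by (rule nn_integral_cmult) (simp add: U_def)
    also have "(\<integral>\<^sup>+x'. G (x - x') \<partial>U) = ennreal (1 / 2) * H x"
      unfolding U_def H_def by (rule nn_integral_uniform_Icc) measurable
    finally show ?thesis by (simp only: mult.assoc[symmetric] ennreal_mult[symmetric]) simp
  qed
  have "(\<integral>\<^sup>+x. \<integral>\<^sup>+x'. \<integral>\<^sup>+t. g ((x - x') / 2 + \<sigma> * (1 - \<bar>x - x'\<bar> / 2) * t) \<partial>U \<partial>U \<partial>U)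
     = (\<integral>\<^sup>+x. ennreal (1 / 4) * H x \<partial>U)"
    by (simp only: inner middle)
  also have "\<dots> = ennreal (1 / 4) * (\<integral>\<^sup>+x. H x \<partial>U)"
    by (rule nn_integral_cmult) (simp add: U_def)
  also have "(\<integral>\<^sup>+x. H x \<partial>U) = ennreal (1 / 2) * (\<integral>\<^sup>+x. H x * indicator {-1..1} x \<partial>lborel)"
    unfolding U_def by (rule nn_integral_uniform_Icc) measurable
  also have "(\<integral>\<^sup>+x. H x * indicator {-1..1} x \<partial>lborel) = 4 * (\<integral>\<^sup>+y. g y * indicator {-1..1} y \<partial>lborel)"
    unfolding H_def E[symmetric] by (rule nn_integral_difference_Icc) measurable
  also have "ennreal (1 / 4) * (ennreal (1 / 2) * (4 * (\<integral>\<^sup>+y. g y * indicator {-1..1} y \<partial>lborel)))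
     = (ennreal (1 / 4) * ennreal (1 / 2) * ennreal 4) * (\<integral>\<^sup>+y. g y * indicator {-1..1} y \<partial>lborel)"
    by (simp only: mult.assoc ennreal_numeral)
  also have "ennreal (1 / 4) * ennreal (1 / 2) * ennreal 4 = ennreal (1 / 2)"
    by (subst ennreal_mult[symmetric], simp, simp, subst ennreal_mult[symmetric]) simp_all
  also have "ennreal (1 / 2) * (\<integral>\<^sup>+y. g y * indicator {-1..1} y \<partial>lborel) = (\<integral>\<^sup>+y. g y \<partial>U)"
    unfolding U_def by (rule nn_integral_uniform_Icc[symmetric]) measurable
  finally show ?thesis .
qed

text \<open>By independence the joint law of the three variables is a product of uniform laws;
  integrating out one coordinate at a time leads to the triple integral above. The sign
  \<open>\<sigma>\<close> covers both samples of a pair at once.\<close>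

lemma uniform_rv_pair_sum:
  fixes Z :: "'i \<Rightarrow> 'w \<Rightarrow> real"
  assumes M: "prob_space M" and indep: "prob_space.indep_vars M (\<lambda>_. borel) Z J"
    and J: "i \<in> J" "j \<in> J" "k \<in> J" "i \<noteq> j" "i \<noteq> k" "j \<noteq> k"
    and unif: "uniform_rv M (Z i)" "uniform_rv M (Z j)" "uniform_rv M (Z k)"
    and \<sigma>: "\<bar>\<sigma>\<bar> = 1"
    and Y: "\<And>\<omega>. Y \<omega> = (Z i \<omega> - Z j \<omega>) / 2 + \<sigma> * (1 - \<bar>Z i \<omega> - Z j \<omega>\<bar> / 2) * Z k \<omega>"
  shows "uniform_rv M Y"
proof -
  interpret prob_space M by (rule M)
  define U where "U = uniform_measure lborel {-1..1::real}"
  have [simp, measurable_cong]: "sets U = sets borel" by (simp add: U_def)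
  have [simp]: "space U = UNIV" by (simp add: U_def)
  interpret U: prob_space U
    unfolding U_def by (rule prob_space_uniform_measure) auto
  interpret product_sigma_finite "\<lambda>_::'i. U"
    by standard
  let ?K = "{i, j, k}"
  have Zm: "Z l \<in> borel_measurable M" "distr M borel (Z l) = U" if "l \<in> ?K" for l
    using that unif by (auto simp: uniform_rv_def U_def)
  note [measurable] = Zm(1)[of i, simplified] Zm(1)[of j, simplified] Zm(1)[of k, simplified]
  have Ym[measurable]: "Y \<in> borel_measurable M"
    unfolding Y[abs_def] by measurable
  have "indep_vars (\<lambda>_. borel) Z ?K"
    using indep by (rule indep_vars_subset) (use J in auto)
  then have "distr M (\<Pi>\<^sub>M l\<in>?K. borel) (\<lambda>\<omega>. \<lambda>l\<in>?K. Z l \<omega>) = (\<Pi>\<^sub>M l\<in>?K. distr M borel (Z l))"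
    using Zm(1) by (subst (asm) indep_vars_iff_distr_eq_PiM') auto
  also have "\<dots> = (\<Pi>\<^sub>M l\<in>?K. U)"
    by (intro PiM_cong) (auto simp: Zm(2))
  finally have joint: "distr M (\<Pi>\<^sub>M l\<in>?K. borel) (\<lambda>\<omega>. \<lambda>l\<in>?K. Z l \<omega>) = (\<Pi>\<^sub>M l\<in>?K. U)" .
  have Zr: "(\<lambda>\<omega>. \<lambda>l\<in>?K. Z l \<omega>) \<in> measurable M (\<Pi>\<^sub>M l\<in>?K. borel)"
    by (rule measurable_restrict) (rule Zm(1))
  let ?h = "\<lambda>z. (z i - z j) / 2 + \<sigma> * (1 - \<bar>z i - z j\<bar> / 2) * z k :: real"
  have hm[measurable]: "?h \<in> borel_measurable (\<Pi>\<^sub>M l\<in>?K. (borel :: real measure))"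
    by measurable
  have hm'[measurable]: "?h \<in> borel_measurable (\<Pi>\<^sub>M l\<in>?K. U)"
    by measurable
  have "distr M borel Y = U"
  proof (rule measure_eqI)
    fix A assume "A \<in> sets (distr M borel Y)"
    then have A[measurable]: "A \<in> sets borel" by simp
    have "emeasure (distr M borel Y) A = (\<integral>\<^sup>+y. indicator A y \<partial>distr M borel Y)"
      by simp
    also have "\<dots> = (\<integral>\<^sup>+\<omega>. indicator A (?h (\<lambda>l\<in>?K. Z l \<omega>)) \<partial>M)"
      by (subst nn_integral_distr) (auto simp: Y)
    also have "\<dots> = (\<integral>\<^sup>+z. indicator A (?h z) \<partial>distr M (\<Pi>\<^sub>M l\<in>?K. borel) (\<lambda>\<omega>. \<lambda>l\<in>?K. Z l \<omega>))"
      by (rule nn_integral_distr[symmetric, OF Zr]) measurable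
    also have "\<dots> = (\<integral>\<^sup>+z. indicator A (?h z) \<partial>(\<Pi>\<^sub>M l\<in>?K. U))"
      unfolding joint ..
    also have "\<dots> = (\<integral>\<^sup>+x. \<integral>\<^sup>+z. indicator A (?h (z(i := x))) \<partial>(\<Pi>\<^sub>M l\<in>{j, k}. U) \<partial>U)"
      using J by (intro product_nn_integral_insert_rev) (auto, measurable)
    also have "\<dots> = (\<integral>\<^sup>+x. \<integral>\<^sup>+x'. \<integral>\<^sup>+z. indicator A (?h (z(j := x', i := x))) \<partial>(\<Pi>\<^sub>M l\<in>{k}. U) \<partial>U \<partial>U)"
      using J by (intro nn_integral_cong, subst product_nn_integral_insert_rev) (auto simp: fun_upd_twist)
    also have "\<dots> = (\<integral>\<^sup>+x. \<integral>\<^sup>+x'. \<integral>\<^sup>+t. indicator A ((x - x') / 2 + \<sigma> * (1 - \<bar>x - x'\<bar> / 2) * t) \<partial>U \<partial>U \<partial>U)"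
      using J
      by (intro nn_integral_cong, subst product_nn_integral_singleton[symmetric, where i=k]) (auto, measurable)
    also have "\<dots> = (\<integral>\<^sup>+y. indicator A y \<partial>U)"
      unfolding U_def using \<sigma> by (intro nn_integral_pair_sum_uniform) auto
    finally show "emeasure (distr M borel Y) A = emeasure U A" by simp
  qed simp
  then show ?thesis by (simp add: uniform_rv_def U_def)
qed

section \<open>The balanced hyperplane and polytope\<close>

definition unit_normal :: "real ^ 'n" where
  "unit_normal = (\<chi> i. 1 / sqrt (real CARD('n)))"

lemma inner_unit_normal: "unit_normal \<bullet> x = (\<Sum>i\<in>UNIV. x $ i) / sqrt (real CARD('n))"
  for x :: "real ^ 'n"
  by (simp add: unit_normal_def inner_vec_def sum_divide_distrib)

lemma norm_unit_normal: "norm (unit_normal :: real ^ 'n) = 1"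
  by (simp add: norm_eq_1 inner_unit_normal) (simp add: unit_normal_def real_div_sqrt)

lemma balanced_hyperplane_eq: "balanced_hyperplane = {x. unit_normal \<bullet> x = 0}"
  by (auto simp: balanced_hyperplane_def inner_unit_normal)

lemma subspace_balanced_hyperplane: "subspace balanced_hyperplane"
  unfolding balanced_hyperplane_eq by (rule subspace_hyperplane)

lemma dim_balanced_hyperplane: "dim (balanced_hyperplane :: (real ^ 'n) set) = CARD('n) - 1"
proof -
  have "unit_normal \<noteq> (0 :: real ^ 'n)"
    using norm_unit_normal[where 'n='n] by auto
  then show ?thesis unfolding balanced_hyperplane_eq by (simp add: dim_hyperplane)
qed

lemma closed_balanced_polytope: "closed balanced_polytope"
proof -
  have "balanced_polytope = {x. unit_normal \<bullet> x = 0} \<inter> (\<Inter>i. {x. -1 \<le> x $ i} \<inter> {x. x $ i \<le> 1})"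
    by (auto simp: balanced_polytope_def balanced_hyperplane_eq)
  also have "closed \<dots>"
    by (intro closed_Int closed_INT closed_hyperplane ballI closed_Collect_le continuous_intros)
  finally show ?thesis .
qed

lemma bounded_balanced_polytope: "bounded (balanced_polytope :: (real ^ 'n) set)"
proof -
  have "norm x \<le> real CARD('n)" if "x \<in> balanced_polytope" for x :: "real ^ 'n"
  proof -
    have "norm x \<le> (\<Sum>i\<in>UNIV. \<bar>x $ i\<bar>)" by (rule norm_le_l1_cart)
    also have "\<dots> \<le> (\<Sum>i\<in>(UNIV :: 'n set). 1)"
      using that by (intro sum_mono) (auto simp: balanced_polytope_def abs_le_iff minus_le_iff)
    finally show ?thesis by simp
  qed
  then show ?thesis by (meson boundedI)
qed

text \<open>Boundedness of the polytope gives finiteness, which makes the Radon--Nikodym theorem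
  available with this reference measure.\<close>

lemma finite_measure_polytope_volume: "finite_measure (polytope_volume :: (real ^ 'n) measure)"
proof
  let ?L = "lborel_subspace balanced_hyperplane :: (real ^ 'n) measure"
  have P: "balanced_polytope \<in> sets (borel :: (real ^ 'n) measure)"
    by (rule borel_closed) (rule closed_balanced_polytope)
  have "emeasure polytope_volume (space (polytope_volume :: (real ^ 'n) measure)) = emeasure ?L balanced_polytope"
    unfolding polytope_volume_def using P
    by (subst emeasure_density) (auto intro!: borel_measurable_indicator nn_integral_indicator)
  also have "\<dots> \<le> ennreal ((2 * diameter (balanced_polytope :: (real ^ 'n) set)) ^ dim (balanced_hyperplane :: (real ^ 'n) set))"
    using P by (intro emeasure_lborel_subspace_le subspace_balanced_hyperplane bounded_balanced_polytope)
  also have "\<dots> < \<infinity>" by simp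
  finally show "emeasure polytope_volume (space (polytope_volume :: (real ^ 'n) measure)) \<noteq> \<infinity>"
    by simp
qed

lemma null_sets_polytope_volume:
  fixes A :: "(real ^ 'n) set"
  assumes "A \<in> null_sets polytope_volume"
  shows "A \<inter> balanced_polytope \<in> null_sets (lborel_subspace balanced_hyperplane)"
proof -
  let ?L = "lborel_subspace balanced_hyperplane :: (real ^ 'n) measure"
  have P[measurable]: "balanced_polytope \<in> sets (borel :: (real ^ 'n) measure)"
    by (rule borel_closed) (rule closed_balanced_polytope)
  have A[measurable]: "A \<in> sets borel"
    using assms by (auto simp: null_sets_def polytope_volume_def)
  have "emeasure ?L (A \<inter> balanced_polytope) = (\<integral>\<^sup>+x. indicator (A \<inter> balanced_polytope) x \<partial>?L)"
    by (rule nn_integral_indicator[symmetric]) simp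
  also have "\<dots> = (\<integral>\<^sup>+x. indicator balanced_polytope x * indicator A x \<partial>?L)"
    by (intro nn_integral_cong) (auto simp: indicator_def)
  also have "\<dots> = emeasure polytope_volume A"
    unfolding polytope_volume_def by (rule emeasure_density[symmetric]) auto
  also have "\<dots> = 0" using assms by (simp add: null_sets_def)
  finally show ?thesis by (simp add: null_sets_def)
qed

section \<open>Absolute continuity of the distribution\<close>

text \<open>\<open>p\<close> and \<open>q\<close> list the odd and the even places of the sample
  vector. There are as many input variables as samples, so one vector type serves both: an input
  vector holds \<open>X k\<close> at \<open>p k\<close> and \<open>T k\<close> at
  \<open>q k\<close>.\<close>

locale paired_coordinates =
  fixes m :: nat and p q :: "nat \<Rightarrow> 'n::finite"
  assumes m: "1 < m"
    and inj_p: "inj_on p {1..m}" and inj_q: "inj_on q {1..m}"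
    and disjoint: "p ` {1..m} \<inter> q ` {1..m} = {}"
    and cover: "p ` {1..m} \<union> q ` {1..m} = UNIV"
begin

text \<open>Written as a sum of axis vectors, it is visibly linear in the entries, which suits both
  differentiation and coordinates along a basis.\<close>

definition join :: "(nat \<Rightarrow> real) \<Rightarrow> (nat \<Rightarrow> real) \<Rightarrow> real ^ 'n" where
  "join f h = (\<Sum>k = 1..m. f k *\<^sub>R axis (p k) 1 + h k *\<^sub>R axis (q k) 1)"

lemma join_p [simp]:
  assumes k: "k \<in> {1..m}"
  shows "join f h $ p k = f k"
proof -
  have "join f h $ p k = (\<Sum>l = 1..m. if l = k then f k else 0)"
    unfolding join_def sum_component
  proof (rule sum.cong[OF refl])
    fix l assume l: "l \<in> {1..m}"
    have "p l = p k \<longleftrightarrow> l = k" using inj_onD[OF inj_p _ l k] by auto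
    moreover have "q l \<noteq> p k" using disjoint k l by blast
    ultimately show "(f l *\<^sub>R axis (p l) 1 + h l *\<^sub>R axis (q l) 1) $ p k = (if l = k then f k else 0)"
      by (auto simp: axis_def)
  qed
  then show ?thesis using k by simp
qed

lemma join_q [simp]:
  assumes k: "k \<in> {1..m}"
  shows "join f h $ q k = h k"
proof -
  have "join f h $ q k = (\<Sum>l = 1..m. if l = k then h k else 0)"
    unfolding join_def sum_component
  proof (rule sum.cong[OF refl])
    fix l assume l: "l \<in> {1..m}"
    have "q l = q k \<longleftrightarrow> l = k" using inj_onD[OF inj_q _ l k] by auto
    moreover have "p l \<noteq> q k" using disjoint k l by blast
    ultimately show "(f l *\<^sub>R axis (p l) 1 + h l *\<^sub>R axis (q l) 1) $ q k = (if l = k then h k else 0)"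
      by (auto simp: axis_def)
  qed
  then show ?thesis using k by simp
qed

lemma paired_vec_eqI:
  fixes x y :: "real ^ 'n"
  assumes "\<And>k. k \<in> {1..m} \<Longrightarrow> x $ p k = y $ p k" "\<And>k. k \<in> {1..m} \<Longrightarrow> x $ q k = y $ q k"
  shows "x = y"
proof -
  have "x $ i = y $ i" for i
  proof -
    have "i \<in> p ` {1..m} \<union> q ` {1..m}" using cover by simp
    then show ?thesis using assms by blast
  qed
  then show ?thesis by (simp add: vec_eq_iff)
qed

lemma sum_UNIV_paired: "(\<Sum>i\<in>UNIV. g i) = (\<Sum>k = 1..m. g (p k) + g (q k))"
  for g :: "'n \<Rightarrow> real"
  unfolding cover[symmetric]
  by (subst sum.union_disjoint[OF _ _ disjoint])
    (simp_all only: finite_imageI finite_atLeastAtMost sum.reindex[OF inj_p] sum.reindex[OF inj_q] sum.distrib o_def)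

lemma card_paired: "CARD('n) = 2 * m"
proof -
  have "card (p ` {1..m} \<union> q ` {1..m}) = m + m"
    by (subst card_Un_disjoint[OF _ _ disjoint])
      (simp_all only: finite_imageI finite_atLeastAtMost card_image[OF inj_p] card_image[OF inj_q], simp)
  then show ?thesis unfolding cover by simp
qed

section \<open>Cyclic differences and the sample map\<close>

definition succ :: "nat \<Rightarrow> nat" where
  "succ k = (if k = m then 1 else k + 1)"

text \<open>\<open>1 < m\<close> excludes a fixed point of the cyclic shift, so each difference
  involves two distinct variables.\<close>

lemma succ_in: "k \<in> {1..m} \<Longrightarrow> succ k \<in> {1..m}"
  and succ_neq: "succ k \<noteq> k"
  using m by (auto simp: succ_def)

definition diff :: "real ^ 'n \<Rightarrow> nat \<Rightarrow> real" where
  "diff z k = z $ p k - z $ p (succ k)"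

lemma sum_diff_less:
  assumes "k \<in> {1..m}"
  shows "(\<Sum>j = 1..<k. diff z j) = z $ p 1 - z $ p k"
proof -
  \<comment> \<open>Indices \<open>j < k \<le> m\<close> do not wrap around, so
    \<open>succ j = Suc j\<close> and the sum telescopes.\<close>
  have "(\<Sum>j = 1..<k. diff z j) = (\<Sum>j = 1..<k. z $ p j - z $ p (Suc j))"
    using assms by (intro sum.cong) (auto simp: diff_def succ_def)
  also have "\<dots> = - (\<Sum>j = 1..<k. z $ p (Suc j) - z $ p j)"
    by (simp add: sum_negf[symmetric])
  also have "\<dots> = z $ p 1 - z $ p k"
    using assms by (subst sum_Suc_diff') auto
  finally show ?thesis .
qed

lemma sum_diff: "(\<Sum>j = 1..m. diff z j) = 0"
proof -
  have "{1..m} = insert m {1..<m}" using m by auto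
  then have "(\<Sum>j = 1..m. diff z j) = diff z m + (\<Sum>j = 1..<m. diff z j)" by simp
  then show ?thesis using sum_diff_less[of m z] m by (simp add: diff_def succ_def)
qed

text \<open>The construction of the samples as a deterministic map of the inputs, so that absolute
  continuity becomes a statement about preimages of null sets.\<close>

definition rbs :: "real ^ 'n \<Rightarrow> real ^ 'n" where
  "rbs z = join (\<lambda>k. diff z k / 2 + (1 - \<bar>diff z k\<bar> / 2) * z $ q k)
                (\<lambda>k. diff z k / 2 - (1 - \<bar>diff z k\<bar> / 2) * z $ q k)"

lemma sum_rbs: "(\<Sum>i\<in>UNIV. rbs z $ i) = 0"
proof -
  have "(\<Sum>i\<in>UNIV. rbs z $ i) = (\<Sum>k = 1..m. diff z k)"
    unfolding sum_UNIV_paired by (intro sum.cong) (auto simp: rbs_def)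
  then show ?thesis using sum_diff by simp
qed

text \<open>The coordinate \<open>z $ p 1\<close>, which \<open>rbs\<close> forgets, is stored along the normal of the
  hyperplane, so that the lifted map is almost everywhere injective between spaces of equal
  dimension.\<close>

definition lift :: "real ^ 'n \<Rightarrow> real ^ 'n" where
  "lift z = rbs z + (z $ p 1) *\<^sub>R unit_normal"

definition proj :: "real ^ 'n \<Rightarrow> real ^ 'n" where
  "proj w = w - (unit_normal \<bullet> w) *\<^sub>R unit_normal"

text \<open>Reads the inputs off \<open>lift z\<close>: the samples of pair \<open>k\<close> add up
  to \<open>diff z k\<close>, so telescoping from the stored \<open>z $ p 1\<close> recovers each
  \<open>z $ p k\<close>; their difference is \<open>(2 - \<bar>diff z k\<bar>) * z $ q k\<close>,
  which is solved for \<open>z $ q k\<close>.\<close>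

definition unlift :: "real ^ 'n \<Rightarrow> real ^ 'n" where
  "unlift w = join
     (\<lambda>k. unit_normal \<bullet> w - (\<Sum>j = 1..<k. proj w $ p j + proj w $ q j))
     (\<lambda>k. (proj w $ p k - proj w $ q k) / (2 - \<bar>proj w $ p k + proj w $ q k\<bar>))"

lemma inner_lift: "unit_normal \<bullet> lift z = z $ p 1"
  using norm_unit_normal[where 'n='n]
  by (simp add: lift_def inner_add_right norm_eq_1) (simp add: inner_unit_normal sum_rbs)

lemma proj_lift: "proj (lift z) = rbs z"
  by (simp add: proj_def inner_lift) (simp add: lift_def)

lemma rbs_add: "k \<in> {1..m} \<Longrightarrow> rbs z $ p k + rbs z $ q k = diff z k"
  by (simp add: rbs_def)

lemma rbs_diff: "k \<in> {1..m} \<Longrightarrow> rbs z $ p k - rbs z $ q k = (2 - \<bar>diff z k\<bar>) * z $ q k"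
  by (simp add: rbs_def algebra_simps)

lemma unlift_lift:
  assumes "\<And>k. k \<in> {1..m} \<Longrightarrow> \<bar>diff z k\<bar> \<noteq> 2"
  shows "unlift (lift z) = z"
proof (rule paired_vec_eqI)
  fix k assume k: "k \<in> {1..m}"
  have "(\<Sum>j = 1..<k. rbs z $ p j + rbs z $ q j) = (\<Sum>j = 1..<k. diff z j)"
    using k by (intro sum.cong) (auto simp: rbs_add)
  then show "unlift (lift z) $ p k = z $ p k"
    using k sum_diff_less[OF k, of z] by (simp add: unlift_def proj_lift inner_lift)
  show "unlift (lift z) $ q k = z $ q k"
    using k assms[OF k] by (simp add: unlift_def proj_lift rbs_add rbs_diff)
qed

text \<open>The excluded points are those where an absolute value has its kink and those where a
  denominator vanishes; elsewhere only linear maps, absolute values and quotients are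
  composed.\<close>

lemma differentiable_unlift:
  assumes "\<And>k. k \<in> {1..m} \<Longrightarrow> proj w $ p k + proj w $ q k \<noteq> 0"
    and "\<And>k. k \<in> {1..m} \<Longrightarrow> \<bar>proj w $ p k + proj w $ q k\<bar> \<noteq> 2"
  shows "unlift differentiable (at w)"
proof -
  have proj: "(\<lambda>w. proj w $ i) differentiable (at w)" for i
    unfolding proj_def
    by (intro linear_imp_differentiable linearI)
      (auto simp: inner_add_right algebra_simps)
  have norm: "(\<lambda>w. \<bar>proj w $ p k + proj w $ q k\<bar>) differentiable (at w)" if "k \<in> {1..m}" for k
  proof -
    have "(norm \<circ> (\<lambda>w. proj w $ p k + proj w $ q k)) differentiable (at w)"
      using assms(1)[OF that]
      by (intro differentiable_chain_at differentiable_add proj differentiable_norm_at)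
    then show ?thesis by (simp add: o_def)
  qed
  have scale: "(\<lambda>w. f w *\<^sub>R v) differentiable (at w)" if "f differentiable (at w)"
    for f :: "real ^ 'n \<Rightarrow> real" and v :: "real ^ 'n"
    using that by (intro differentiable_scaleR) auto
  show ?thesis
    unfolding unlift_def join_def using assms(2)
    by (intro differentiable_sum ballI differentiable_add scale differentiable_diff
        differentiable_divide proj norm differentiable_const differentiable_inner differentiable_ident)
      auto
qed

lemma borel_measurable_rbs [measurable]: "rbs \<in> borel_measurable borel"
  unfolding rbs_def join_def diff_def
  by (intro borel_measurable_continuous_onI continuous_intros) auto

text \<open>The set is an affine hyperplane; its normal is nonzero because \<open>p k\<close> and
  \<open>p (succ k)\<close> are different coordinates.\<close>

lemma negligible_diff_eq:
  assumes k: "k \<in> {1..m}"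
  shows "negligible {z. diff z k = c}"
proof -
  let ?v = "axis (p k) 1 - axis (p (succ k)) 1 :: real ^ 'n"
  have "p k \<noteq> p (succ k)"
    using inj_onD[OF inj_p _ k succ_in[OF k]] succ_neq[of k] by auto
  then have "?v $ p k \<noteq> 0" by (simp add: axis_def)
  then have "?v \<noteq> 0" by (metis zero_index)
  moreover have "{z. diff z k = c} = {z. ?v \<bullet> z = c}"
    by (auto simp: diff_def inner_diff_left inner_axis')
  ultimately show ?thesis by (simp add: negligible_hyperplane)
qed

text \<open>Up to finitely many hyperplanes, the preimage lies in the image under
  \<open>unlift\<close> of the cylinder over \<open>A\<close>. The cylinder is null, and
  \<open>unlift\<close> is differentiable between spaces of equal dimension, so the image is
  negligible.\<close>

lemma negligible_rbs_vimage:
  assumes A: "A \<in> null_sets (lborel_subspace balanced_hyperplane)"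
  shows "negligible (rbs -` A)"
proof -
  let ?G = "{w. \<forall>k\<in>{1..m}. proj w $ p k + proj w $ q k \<noteq> 0 \<and> \<bar>proj w $ p k + proj w $ q k\<bar> \<noteq> 2}"
  let ?N = "{w. proj w \<in> A}"
  have "?N \<in> null_sets lborel"
    using null_sets_lborel_subspace_hyperplane[OF norm_unit_normal, of A] A
    unfolding balanced_hyperplane_eq proj_def by simp
  then have "negligible ?N"
    by (simp add: negligible_iff_null_sets null_sets_completionI)
  then have "negligible (unlift ` (?N \<inter> ?G))"
    by (intro negligible_differentiable_image_negligible)
      (auto simp: negligible_Int intro!: differentiable_at_imp_differentiable_on differentiable_unlift)
  \<comment> \<open>At 0 the absolute value has its kink; at 2 and -2 the coefficient of
    \<open>z $ q k\<close> vanishes and that coordinate cannot be recovered.\<close>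
  moreover have "negligible (\<Union>k\<in>{1..m}. \<Union>c\<in>{0, 2, -2}. {z. diff z k = c})"
    using negligible_diff_eq by (auto intro!: negligible_Union)
  moreover have "rbs -` A \<subseteq> unlift ` (?N \<inter> ?G) \<union> (\<Union>k\<in>{1..m}. \<Union>c\<in>{0, 2, -2}. {z. diff z k = c})"
  proof
    fix z assume z: "z \<in> rbs -` A"
    show "z \<in> unlift ` (?N \<inter> ?G) \<union> (\<Union>k\<in>{1..m}. \<Union>c\<in>{0, 2, -2}. {z. diff z k = c})"
    proof (cases "\<exists>k\<in>{1..m}. diff z k = 0 \<or> \<bar>diff z k\<bar> = 2")
      case True
      then obtain k where "k \<in> {1..m}" "diff z k \<in> {0, 2, -2}" by (auto simp: abs_if split: if_splits)
      then show ?thesis by blast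
    next
      case False
      then have "lift z \<in> ?N \<inter> ?G" using z by (auto simp: proj_lift rbs_add)
      moreover have "z = unlift (lift z)" using False by (intro unlift_lift[symmetric]) auto
      ultimately show ?thesis by blast
    qed
  qed
  ultimately show ?thesis
    using negligible_subset negligible_Un by blast
qed

text \<open>Mutual independence makes the joint law of all inputs a product of uniform laws, which
  is absolutely continuous; \<open>join\<close> merely assembles the coordinates along the axis
  vectors \<open>e\<close>.\<close>

lemma AE_join_uniform:
  fixes M :: "'w measure"
  assumes M: "prob_space M"
    and indep: "prob_space.indep_vars M (\<lambda>_. borel) (case_sum X T) ({1..m} <+> {1..m})"
    and X: "\<And>k. k \<in> {1..m} \<Longrightarrow> uniform_rv M (X k)"
    and T: "\<And>k. k \<in> {1..m} \<Longrightarrow> uniform_rv M (T k)"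
    and N: "N \<in> null_sets lborel"
  shows "AE \<omega> in M. join (\<lambda>k. X k \<omega>) (\<lambda>k. T k \<omega>) \<notin> N"
proof -
  interpret prob_space M by (rule M)
  let ?I = "{1..m} <+> {1..m}"
  let ?Z = "case_sum X T"
  let ?U = "uniform_measure lborel {-1..1::real}"
  define e :: "nat + nat \<Rightarrow> real ^ 'n" where "e = case_sum (\<lambda>k. axis (p k) 1) (\<lambda>k. axis (q k) 1)"
  have fin: "finite ?I" by simp
  have Zm: "?Z i \<in> borel_measurable M" "distr M borel (?Z i) = ?U" if "i \<in> ?I" for i
    using that X T by (auto simp: uniform_rv_def)
  have join_eq: "join (\<lambda>k. t (Inl k)) (\<lambda>k. t (Inr k)) = (\<Sum>i\<in>?I. t i *\<^sub>R e i)" for t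
    by (simp add: join_def e_def sum.Plus sum.distrib)
  have pq: "p k \<noteq> q l" "q l \<noteq> p k" if "k \<in> {1..m}" "l \<in> {1..m}" for k l
    using disjoint that by blast+
  have inj: "inj_on e ?I"
  proof (rule inj_onI)
    fix i j assume "i \<in> ?I" "j \<in> ?I" "e i = e j"
    then show "i = j"
      using pq inj_on_eq_iff[OF inj_p] inj_on_eq_iff[OF inj_q]
      by (elim PlusE) (simp_all add: e_def axis_eq_axis)
  qed
  have "e ` ?I \<subseteq> Basis" by (auto simp: e_def Basis_vec_def)
  then have ind: "independent (e ` ?I)" by (rule independent_mono[OF independent_Basis])
  have card: "card ?I = DIM(real ^ 'n)" by (simp add: card_Plus card_paired)
  have [measurable]: "N \<in> sets borel" using N by auto
  have "{t \<in> space (\<Pi>\<^sub>M i\<in>?I. lborel). (\<Sum>i\<in>?I. t i *\<^sub>R e i) \<in> N} \<in> null_sets (\<Pi>\<^sub>M i\<in>?I. lborel)"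
    using null_sets_basis_coords[OF fin inj ind card, of N] N by simp
  then have "{t \<in> space (\<Pi>\<^sub>M i\<in>?I. lborel). (\<Sum>i\<in>?I. t i *\<^sub>R e i) \<in> N} \<in> null_sets (\<Pi>\<^sub>M i\<in>?I. ?U)"
    by (intro null_sets_PiM_uniform_measure) auto
  then have AE: "AE t in (\<Pi>\<^sub>M i\<in>?I. ?U). (\<Sum>i\<in>?I. t i *\<^sub>R e i) \<notin> N"
    by (rule AE_I') (auto simp: space_PiM)
  have "(\<Pi>\<^sub>M i\<in>?I. ?U) = (\<Pi>\<^sub>M i\<in>?I. distr M borel (?Z i))"
    using Zm(2) by (intro PiM_cong) auto
  also have "\<dots> = distr M (\<Pi>\<^sub>M i\<in>?I. borel) (\<lambda>\<omega>. \<lambda>i\<in>?I. ?Z i \<omega>)"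
    using indep Zm(1) m by (subst (asm) indep_vars_iff_distr_eq_PiM') auto
  finally have joint: "(\<Pi>\<^sub>M i\<in>?I. ?U) = distr M (\<Pi>\<^sub>M i\<in>?I. borel) (\<lambda>\<omega>. \<lambda>i\<in>?I. ?Z i \<omega>)" .
  have "AE \<omega> in M. (\<Sum>i\<in>?I. (\<lambda>i\<in>?I. ?Z i \<omega>) i *\<^sub>R e i) \<notin> N"
    using AE unfolding joint
    by (subst (asm) AE_distr_iff) (auto intro!: measurable_restrict Zm(1))
  then show ?thesis
  proof eventually_elim
    case (elim \<omega>)
    have "(\<Sum>i\<in>?I. (\<lambda>i\<in>?I. ?Z i \<omega>) i *\<^sub>R e i) = (\<Sum>i\<in>?I. ?Z i \<omega> *\<^sub>R e i)"
      by (intro sum.cong) auto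
    then show ?case using elim join_eq[of "\<lambda>i. ?Z i \<omega>"] by simp
  qed
qed

lemma AE_rbs_not_in:
  fixes M :: "'w measure"
  assumes "prob_space M"
    and "prob_space.indep_vars M (\<lambda>_. borel) (case_sum X T) ({1..m} <+> {1..m})"
    and "\<And>k. k \<in> {1..m} \<Longrightarrow> uniform_rv M (X k)"
    and "\<And>k. k \<in> {1..m} \<Longrightarrow> uniform_rv M (T k)"
    and A: "A \<in> null_sets (lborel_subspace balanced_hyperplane)"
  shows "AE \<omega> in M. rbs (join (\<lambda>k. X k \<omega>) (\<lambda>k. T k \<omega>)) \<notin> A"
proof -
  have "rbs -` A \<in> sets borel"
    using measurable_sets[OF borel_measurable_rbs, of A] A by (simp add: null_sets_def)
  then have "rbs -` A \<in> null_sets lborel"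
    using negligible_rbs_vimage[OF A] by (simp add: negligible_iff_null_sets null_sets_completion_iff)
  then have "AE \<omega> in M. join (\<lambda>k. X k \<omega>) (\<lambda>k. T k \<omega>) \<notin> rbs -` A"
    using assms by (intro AE_join_uniform) auto
  then show ?thesis by simp
qed

end

text \<open>Vectors are indexed by a finite type, so the bijection \<open>idx\<close> numbers its
  elements by 1 to \<open>2 * m\<close> and thereby fixes the size of the sample.\<close>

theorem theorem6:
  fixes M :: "'w measure" and m :: nat
    and X T S Y :: "nat \<Rightarrow> 'w \<Rightarrow> real"
    and idx :: "nat \<Rightarrow> 'n::finite"
    and Yvec :: "'w \<Rightarrow> real ^ 'n"
  assumes "prob_space M"
    and "m > 1"
    and "prob_space.indep_vars M (\<lambda>_. borel) (case_sum X T) ({1..m} <+> {1..m})"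
    and "\<And>k. k \<in> {1..m} \<Longrightarrow> uniform_rv M (X k)"
    and "\<And>k. k \<in> {1..m} \<Longrightarrow> uniform_rv M (T k)"
    and "X (m + 1) = X 1"
    and "\<And>k \<omega>. k \<in> {1..m} \<Longrightarrow> S k \<omega> = X k \<omega> - X (k + 1) \<omega>"
    and "\<And>k \<omega>. k \<in> {1..m} \<Longrightarrow>
           Y (2 * k - 1) \<omega> = S k \<omega> / 2 + (1 - \<bar>S k \<omega>\<bar> / 2) * T k \<omega>"
    and "\<And>k \<omega>. k \<in> {1..m} \<Longrightarrow>
           Y (2 * k) \<omega> = S k \<omega> / 2 - (1 - \<bar>S k \<omega>\<bar> / 2) * T k \<omega>"
    and "bij_betw idx {1..2 * m} UNIV"
    and "\<And>j \<omega>. j \<in> {1..2 * m} \<Longrightarrow> Yvec \<omega> $ idx j = Y j \<omega>"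
  shows "random_balanced_sample M Yvec \<and>
         maximally_robust M Yvec \<and>
         (\<exists>f. distributed M polytope_volume Yvec f)"
proof (intro conjI)
  interpret prob_space M by (rule assms(1))

  \<comment> \<open>Pairing of the odd and even places\<close>
  define p where "p = (\<lambda>k. idx (2 * k - 1))"
  define q where "q = (\<lambda>k. idx (2 * k))"
  note inj_idx = bij_betw_imp_inj_on[OF assms(10)]
  have idx_eq: "idx i = idx j \<longleftrightarrow> i = j" if "i \<in> {1..2 * m}" "j \<in> {1..2 * m}" for i j
    using inj_on_eq_iff[OF inj_idx] that .
  have range: "2 * k - 1 \<in> {1..2 * m}" "2 * k \<in> {1..2 * m}" if "k \<in> {1..m}" for k
    using that by auto
  interpret paired_coordinates m p q
  proof
    show "1 < m" by (rule assms(2))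
    show "inj_on p {1..m}"
    proof (rule inj_onI)
      fix k l assume "k \<in> {1..m}" "l \<in> {1..m}" "p k = p l"
      then show "k = l" using idx_eq[OF range(1) range(1), of k l] by (simp add: p_def)
    qed
    show "inj_on q {1..m}"
    proof (rule inj_onI)
      fix k l assume "k \<in> {1..m}" "l \<in> {1..m}" "q k = q l"
      then show "k = l" using idx_eq[OF range(2) range(2), of k l] by (simp add: q_def)
    qed
    have "p k \<noteq> q l" if "k \<in> {1..m}" "l \<in> {1..m}" for k l
    proof -
      have "1 \<le> k" using that by simp
      then have "2 * k - 1 \<noteq> 2 * l" by presburger
      then show ?thesis using idx_eq[OF range(1)[OF that(1)] range(2)[OF that(2)]]
        by (simp add: p_def q_def)
    qed
    then show "p ` {1..m} \<inter> q ` {1..m} = {}" by blast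
    show "p ` {1..m} \<union> q ` {1..m} = UNIV"
    proof -
      have "i \<in> p ` {1..m} \<union> q ` {1..m}" for i
      proof -
        obtain j where j: "j \<in> {1..2 * m}" "i = idx j"
          using assms(10) by (force simp: bij_betw_def)
        \<comment> \<open>Rounding up half of \<open>j\<close> sends both \<open>2 * k - 1\<close>
          and \<open>2 * k\<close> to \<open>k\<close>.\<close>
        define k where "k = (j + 1) div 2"
        have k: "k \<in> {1..m}" and jk: "j = 2 * k - 1 \<or> j = 2 * k" using j(1) by (auto simp: k_def)
        then have "i = p k \<or> i = q k" by (auto simp: j(2) p_def q_def)
        then show ?thesis using k by blast
      qed
      then show ?thesis by blast
    qed
  qed
  let ?Z = "\<lambda>\<omega>. join (\<lambda>k. X k \<omega>) (\<lambda>k. T k \<omega>)"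
  \<comment> \<open>The convention \<open>X (m + 1) = X 1\<close> matches the wrap-around of
    \<open>succ\<close> at \<open>m\<close>.\<close>
  have S_eq: "diff (?Z \<omega>) k = S k \<omega>" "S k \<omega> = X k \<omega> - X (succ k) \<omega>" if "k \<in> {1..m}" for k \<omega>
    using that succ_in[OF that] assms(6) assms(7)[OF that, of \<omega>] by (auto simp: diff_def succ_def)
  have Y_p: "Yvec \<omega> $ p k = S k \<omega> / 2 + (1 - \<bar>S k \<omega>\<bar> / 2) * T k \<omega>" if "k \<in> {1..m}" for k \<omega>
    unfolding p_def assms(11)[OF range(1)[OF that]] by (rule assms(8)[OF that])
  have Y_q: "Yvec \<omega> $ q k = S k \<omega> / 2 - (1 - \<bar>S k \<omega>\<bar> / 2) * T k \<omega>" if "k \<in> {1..m}" for k \<omega>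
    unfolding q_def assms(11)[OF range(2)[OF that]] by (rule assms(9)[OF that])
  have Y_eq: "Yvec \<omega> = rbs (?Z \<omega>)" for \<omega>
    by (rule paired_vec_eqI) (simp_all only: Y_p Y_q rbs_def join_p join_q S_eq(1))

  \<comment> \<open>Uniform marginals and balance\<close>
  have unif: "uniform_rv M (\<lambda>\<omega>. Yvec \<omega> $ i)" for i
  proof -
    have "i \<in> p ` {1..m} \<union> q ` {1..m}" using cover by simp
    then obtain k where k: "k \<in> {1..m}" and i: "i = p k \<or> i = q k" by blast
    define \<sigma> :: real where "\<sigma> = (if i = p k then 1 else -1)"
    show ?thesis
    proof (rule uniform_rv_pair_sum[OF assms(1,3)])
      show "Inl k \<in> {1..m} <+> {1..m}" "Inl (succ k) \<in> {1..m} <+> {1..m}" "Inr k \<in> {1..m} <+> {1..m}"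
        using k succ_in[OF k] by auto
      show "Inl k \<noteq> (Inl (succ k) :: nat + nat)" using succ_neq[of k] by auto
      show "uniform_rv M (case_sum X T (Inl k))" "uniform_rv M (case_sum X T (Inl (succ k)))"
        "uniform_rv M (case_sum X T (Inr k))"
        using assms(4)[OF k] assms(4)[OF succ_in[OF k]] assms(5)[OF k] by simp_all
      show "\<bar>\<sigma>\<bar> = 1" by (simp add: \<sigma>_def)
      show "Yvec \<omega> $ i = (case_sum X T (Inl k) \<omega> - case_sum X T (Inl (succ k)) \<omega>) / 2
          + \<sigma> * (1 - \<bar>case_sum X T (Inl k) \<omega> - case_sum X T (Inl (succ k)) \<omega>\<bar> / 2) * case_sum X T (Inr k) \<omega>" for \<omega>
        using i Y_p[OF k, of \<omega>] Y_q[OF k, of \<omega>] unfolding S_eq(2)[OF k]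
        by (auto simp: \<sigma>_def left_diff_distrib)
    qed auto
  qed
  have balanced: "(\<Sum>i\<in>UNIV. Yvec \<omega> $ i) = 0" for \<omega>
    unfolding Y_eq by (rule sum_rbs)
  show "random_balanced_sample M Yvec"
    using balanced unif by (simp add: random_balanced_sample_def)
  have meas[measurable]: "Yvec \<in> borel_measurable M"
    using unif by (subst borel_measurable_euclidean_space)
      (auto simp: uniform_rv_def Basis_vec_def inner_axis)
  \<comment> \<open>Uniformity confines each coordinate to \<open>[-1, 1]\<close> only almost
    surely, whereas the balance condition holds at every point.\<close>
  have AE_polytope: "AE \<omega> in M. Yvec \<omega> \<in> balanced_polytope"
  proof -
    have "AE \<omega> in M. Yvec \<omega> $ i \<in> {-1..1}" for i
    proof -
      have Yi: "(\<lambda>\<omega>. Yvec \<omega> $ i) \<in> borel_measurable M"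
        "distr M borel (\<lambda>\<omega>. Yvec \<omega> $ i) = uniform_measure lborel {-1..1}"
        using unif[of i] by (simp_all add: uniform_rv_def)
      have "AE x in distr M borel (\<lambda>\<omega>. Yvec \<omega> $ i). x \<in> {-1..1}"
        unfolding Yi(2) by (rule AE_uniform_measureI) auto
      then show ?thesis by (rule AE_distrD[OF Yi(1)])
    qed
    then have "AE \<omega> in M. \<forall>i. Yvec \<omega> $ i \<in> {-1..1}"
      by (simp add: AE_all_countable)
    then show ?thesis
      by eventually_elim (simp add: balanced_polytope_def balanced_hyperplane_def balanced)
  qed
  have AE_null: "AE \<omega> in M. Yvec \<omega> \<notin> A"
    if "A \<in> null_sets (lborel_subspace balanced_hyperplane)" for A
    unfolding Y_eq using assms(1,3,4,5) that by (rule AE_rbs_not_in)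

  \<comment> \<open>Dimension of the support\<close>
  let ?N = "distr M borel Yvec"
  let ?supp = "measure_support ?N"
  show "maximally_robust M Yvec"
  proof -
    have P: "balanced_polytope \<in> sets (borel :: (real ^ 'n) measure)"
      by (rule borel_closed) (rule closed_balanced_polytope)
    have "emeasure ?N (- balanced_polytope) = 0"
    proof -
      have "AE x in ?N. x \<in> balanced_polytope"
        using AE_polytope P by (subst AE_distr_iff) auto
      then show ?thesis
        using P by (subst (asm) AE_iff_measurable[of "- balanced_polytope"]) auto
    qed
    then have sub: "?supp \<subseteq> balanced_polytope"
      by (intro measure_support_subset closed_balanced_polytope)
    have borel: "?supp \<in> sets borel" by (intro borel_closed closed_measure_support)
    have AE_supp: "AE \<omega> in M. Yvec \<omega> \<in> ?supp"
      by (rule AE_distrD[OF meas AE_in_measure_support]) simp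
    \<comment> \<open>If the support had volume 0, absolute continuity would make the sample avoid
      it almost surely, although it carries the whole distribution.\<close>
    have "emeasure (lborel_subspace balanced_hyperplane) ?supp \<noteq> 0"
    proof
      assume "emeasure (lborel_subspace balanced_hyperplane) ?supp = 0"
      then have "AE \<omega> in M. Yvec \<omega> \<notin> ?supp"
        using borel by (intro AE_null) (simp add: null_sets_def)
      with AE_supp have "AE \<omega> in M. False" by eventually_elim simp
      then show False by simp
    qed
    then have "hausdorff_dim ?supp = of_nat (dim (balanced_hyperplane :: (real ^ 'n) set))"
      using sub borel assms(2) bounded_subset[OF bounded_balanced_polytope sub]
      by (intro hausdorff_dim_eq_dim_subspace subspace_balanced_hyperplane)
        (auto simp: dim_balanced_hyperplane card_paired balanced_polytope_def)
    then show ?thesis by (simp add: maximally_robust_def dim_balanced_hyperplane)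
  qed

  \<comment> \<open>Existence of the density\<close>
  have sets_vol: "sets (polytope_volume :: (real ^ 'n) measure) = sets borel"
    by (simp add: polytope_volume_def)
  interpret V: finite_measure "polytope_volume :: (real ^ 'n) measure"
    by (rule finite_measure_polytope_volume)
  have "absolutely_continuous polytope_volume ?N"
    unfolding absolutely_continuous_def
  proof
    fix A :: "(real ^ 'n) set" assume A: "A \<in> null_sets polytope_volume"
    then have "A \<in> sets borel" by (auto simp: null_sets_def sets_vol)
    \<comment> \<open>The reference measure vanishes off the polytope, so its null sets are
      controlled only inside; the remaining part of \<open>A\<close> is excluded because the sample
      lies in the polytope almost surely.\<close>
    have "AE \<omega> in M. Yvec \<omega> \<notin> A \<inter> balanced_polytope"
      by (intro AE_null null_sets_polytope_volume A)
    then have "AE \<omega> in M. Yvec \<omega> \<notin> A" using AE_polytope by eventually_elim simp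
    then have "AE x in ?N. x \<notin> A" using \<open>A \<in> sets borel\<close> by (subst AE_distr_iff) auto
    then show "A \<in> null_sets ?N" using \<open>A \<in> sets borel\<close> by (simp add: AE_iff_null_sets)
  qed
  then obtain f where f: "f \<in> borel_measurable polytope_volume" "density polytope_volume f = ?N"
    using V.Radon_Nikodym[of ?N] sets_vol by auto
  \<comment> \<open>\<open>distributed\<close> takes the image measure over the reference measure;
    both targets carry the Borel sets, so it is the same law.\<close>
  have "distr M polytope_volume Yvec = ?N"
    by (rule distr_cong) (auto simp: sets_vol)
  then have "distributed M polytope_volume Yvec f"
    using f meas by (simp add: distributed_def measurable_cong_sets[OF refl sets_vol])
  then show "\<exists>f. distributed M polytope_volume Yvec f" by (rule exI[of _ f])
qed

end
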